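(* Let $M=(S,\mathit{Act},\mathbf{P},\iota,\mathsf{AP},L)$ be a finite MDP and let $\Phi=\forall\sigma_1\ldots\forall\sigma_n.\big(\chi\rightarrow\sum_{i=1}^k c_i\cdot\mathbb{P}(\varphi_i)\bowtie c\big)$ be a PHL formula with $\chi=\forall\pi_1:\sigma_1\ldots\forall\pi_n:\sigma_n.\psi$, where $\psi$ contains no path quantifiers and describes an $n$-safety property, $c_i>0$ for all $i$, $c\in\mathbb{Q}$, and $\bowtie\in\{\le,<\}$. Let $\widetilde M$ be the MDP, $\widetilde\iota$ its initial distribution, and $(x^*_{\widetilde s})_{\widetilde s\in\widetilde S}$ the optimal solution of the linear program, all as constructed in the context. Then $\sum_{\widetilde s\in\widetilde S}\widetilde\iota(\widetilde s)\cdot x^*_{\widetilde s}\bowtie c$ implies $M\models\Phi$.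
   Context: MDPs: $M=(S,\mathit{Act},\mathbf{P},\iota,\mathsf{AP},L)$ with finite $S,\mathit{Act}$, $\mathbf{P}:S\times\mathit{Act}\times S\to[0,1]$, $\sum_{s'}\mathbf{P}(s,a,s')\in\{0,1\}$, initial distribution $\iota$, labelling $L:S\to2^{\mathsf{AP}}$. Schedulers $\mathfrak S:(S\cdot\mathit{Act})^*S\to\mathcal{D}(\mathit{Act})$ choose only enabled actions; $\mathit{Sched}(M)$ denotes all of them; a scheduler induces a Markov chain $M_{\mathfrak S}$ on histories with the usual probability measure $\mathit{Prob}_{M,\mathfrak S}$ on infinite paths. The $n$-self-composition $M^n$ has states $S^n$, actions $\mathit{Act}^n$, $\widehat{\mathbf{P}}((s_i)_i,(a_i)_i,(s'_i)_i)=\prod_i\mathbf{P}(s_i,a_i,s'_i)$, initial distribution $\widehat\iota((s,\dots,s))=\iota(s)$ and $0$ elsewhere, and labels $(L(s_1),\dots,L(s_n))$. Schedulers $\mathfrak S_1,\dots,\mathfrak S_n$ for $M$ compose into $\mathfrak S_1\|\cdots\|\mathfrak S_n$ for $M^n$ choosing $(a_i)_i$ with probability $\prod_i\mathfrak S_i(h_i)(a_i)$, $h_i$ the $i$-th component history. Semantics of $\Phi$ (PHL): $M\models\Phi$ iff for all schedulers $\mathfrak S_1,\dots,\mathfrak S_n\in\mathit{Sched}(M)$, if every tuple of infinite paths $(\rho_1,\dots,\rho_n)$ with $\rho_i$ a path of $M_{\mathfrak S_i}$ satisfies $\psi$ (where $a_{\pi_i}$ means $a$ labels the current state of $\rho_i$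 and temporal operators $\bigcirc,\mathcal U$ advance all paths synchronously), then $\sum_i c_i\cdot\mathit{Prob}_{M^n,\mathfrak S_1\|\cdots\|\mathfrak S_n}(\varphi_i)\bowtie c$. Here each $\varphi_i$ is an LTL formula over propositions $a_{\sigma_j}$ ($a\in\mathsf{AP}$), and $a_{\sigma_j}$ holds in a state $(s_1,\dots,s_n)$ iff $a\in L(s_j)$. That $\psi$ describes an $n$-safety property means there is a deterministic safety automaton $\mathcal D_\psi=(Q,S^n,\delta,q_0)$ (partial transition function, all infinite runs accepting) whose language is exactly the set of words $(s_{0,1},\dots,s_{0,n})(s_{1,1},\dots,s_{1,n})\cdots$ such that the assignment $\pi_i\mapsto s_{0,i}s_{1,i}\cdots$ satisfies $\psi$. Construction. $\widehat M_\chi$: states $S^n\times Q$, actions $\mathit{Act}^n$, $\widehat{\mathbf P}_\chi((\hat s,q),a,(\hat s',q'))=\widehat{\mathbf P}(\hat s,a,\hat s')$ if $q'=\delta(q,\hat s')$ and $0$ otherwise, $\widehat\iota_\chi((\hat s,q))=\widehat\iota(\hat s)$ if $q=\delta(q_0,\hat s)$ and $0$ otherwise, label $\widehat L_\chi((s_1,\dots,s_n,q))=\bigcup_{j}\{a_{\sigma_j}:a\in L(s_j)\}$; states without enabled actions and actions whose successor probabilities do not sum to $1$ are iteratively removed until a valid MDP remains. For each $i$ let $\mathcal A_i=(Q_i,2^{\mathsf{AP}_\sigma},\delta_i,q_{i,0},(B_{i,j},G_{i,j})_{j=1}^{m_i})$ be a deterministic Rabin automaton accepting exactly the words satisfying $\varphi_i$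 (a run is accepting iff for some $j$ it visits $B_{i,j}$ finitely often and $G_{i,j}$ infinitely often). $\widetilde M$: states $\widetilde S=(S^n\times Q)\times Q_1\times\dots\times Q_k$, actions $\mathit{Act}^n$, $\widetilde{\mathbf P}((\hat s,q_1,..,q_k),a,(\hat s',q'_1,..,q'_k))=\widehat{\mathbf P}_\chi(\hat s,a,\hat s')$ if $q'_i=\delta_i(q_i,\widehat L_\chi(\hat s'))$ for all $i$ and $0$ otherwise, $\widetilde\iota((\hat s,q_1,..,q_k))=\widehat\iota_\chi(\hat s)$ if $q_i=\delta_i(q_{i,0},\widehat L_\chi(\hat s))$ for all $i$ and $0$ otherwise. Let $\widetilde B_{i,j},\widetilde G_{i,j}$ be the states of $\widetilde M$ whose $Q_i$-component lies in $B_{i,j}$, resp. $G_{i,j}$. An end component is a nonempty set $E\subseteq\widetilde S$ with a nonempty set of enabled actions per state such that these actions lead only into $E$ and the induced graph is strongly connected. For nonempty $I\subseteq\{1,\dots,k\}$, the success set $U_I$ is the union of all end components $E$ such that for each $i\in I$ there is $j$ with $E\cap\widetilde B_{i,j}=\emptyset$ and $E\cap\widetilde G_{i,j}\ne\emptyset$. The linear program: minimize $\sum_{\widetilde s}x_{\widetilde s}$ subject to $x_{\widetilde s}\ge0$ for all $\widetilde s$; $x_{\widetilde s}\ge\sum_{i\in I}c_i$ for all nonempty $I$ and $\widetilde s\in U_I$; $x_{\widetilde s}\ge\sum_{\widetilde t}\widetilde{\mathbf P}(\widetilde s,a,\widetilde t)x_{\widetilde t}$ for all $\widetilde s\in\widetilde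 S$, $a\in\mathit{Act}^n$. *)

theory Defs
  imports "HOL-Probability.Probability"
begin

section \<open>Markov chains\<close>

text \<open>
  The distribution on infinite paths of the Markov chain with initial distribution \<open>\<iota>\<close> and
  transition kernel \<open>K\<close>: the limit measure of the Ionescu-Tulcea theorem. The lemma
  \<open>measure_mc_measure_cylinder\<close> below gives the measure of the cylinder sets.
\<close>

definition mc_kernel :: "'x pmf \<Rightarrow> ('x \<Rightarrow> 'x pmf) \<Rightarrow> nat \<Rightarrow> (nat \<Rightarrow> 'x) \<Rightarrow> 'x measure" where
  "mc_kernel \<iota> K t \<omega> = measure_pmf (case t of 0 \<Rightarrow> \<iota> | Suc u \<Rightarrow> K (\<omega> u))"

definition mc_measure :: "'x pmf \<Rightarrow> ('x \<Rightarrow> 'x pmf) \<Rightarrow> (nat \<Rightarrow> 'x) measure" where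
  "mc_measure \<iota> K =
     projective_family.lim UNIV
       (Ionescu_Tulcea.CI (mc_kernel \<iota> K) (\<lambda>_. count_space UNIV)) (\<lambda>_. count_space UNIV)"

definition mc_path :: "'x pmf \<Rightarrow> ('x \<Rightarrow> 'x pmf) \<Rightarrow> (nat \<Rightarrow> 'x) \<Rightarrow> bool" where
  "mc_path \<iota> K \<omega> \<longleftrightarrow> \<omega> 0 \<in> set_pmf \<iota> \<and> (\<forall>t. \<omega> (Suc t) \<in> set_pmf (K (\<omega> t)))"

lemma Ionescu_Tulcea_mc_kernel:
  "Ionescu_Tulcea (mc_kernel \<iota> K) (\<lambda>_. count_space UNIV)"
proof (rule Ionescu_Tulcea.intro)
  fix i :: nat
  let ?M = "\<lambda>_::nat. count_space (UNIV :: 'a set)"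
  show "mc_kernel \<iota> K i \<in> measurable (PiM {0..<i} ?M) (subprob_algebra (?M i))"
  proof (cases i)
    case 0
    then show ?thesis
      by (simp add: mc_kernel_def[abs_def] measure_pmf_in_subprob_algebra)
  next
    case (Suc j)
    have "(\<lambda>\<omega>. \<omega> j) \<in> measurable (PiM {0..<i} ?M) (?M j)"
      by (rule measurable_component_singleton) (simp add: Suc)
    moreover have "(\<lambda>x. measure_pmf (K x)) \<in> measurable (?M j) (subprob_algebra (?M i))"
      by (simp add: measure_pmf_in_subprob_algebra)
    ultimately show ?thesis
      using measurable_compose by (fastforce simp: mc_kernel_def[abs_def] Suc)
  qed
next
  show "prob_space (mc_kernel \<iota> K i x)" for i x
    by (simp add: mc_kernel_def measure_pmf.prob_space_axioms)
qed

lemma space_mc_measure [simp]: "space (mc_measure \<iota> K) = UNIV"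
  and sets_mc_measure: "sets (mc_measure \<iota> K) = sets (PiM UNIV (\<lambda>_. count_space UNIV))"
  and prob_space_mc_measure: "prob_space (mc_measure \<iota> K)"
proof -
  interpret Ionescu_Tulcea "mc_kernel \<iota> K" "\<lambda>_. count_space UNIV"
    by (rule Ionescu_Tulcea_mc_kernel)
  show "space (mc_measure \<iota> K) = UNIV"
    by (simp add: mc_measure_def space_PiM)
  show "sets (mc_measure \<iota> K) = sets (PiM UNIV (\<lambda>_. count_space UNIV))"
    by (simp add: mc_measure_def)
  have *: "PF.emb UNIV {} {\<lambda>_. undefined} = (UNIV :: (nat \<Rightarrow> 'a) set)"
    by (auto simp: prod_emb_def space_PiM)
  have "emeasure PF.lim UNIV = emeasure (CI {}) {\<lambda>_. undefined}"
    using lim[of "{}" "{\<lambda>_. undefined}"] unfolding * by (simp add: space_PiM sets_PiM_empty)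
  also have "\<dots> = 1"
    using PF.prob_space_P[of "{}", THEN prob_space.emeasure_space_1]
    by (simp add: PF.space_P space_PiM)
  finally show "prob_space (mc_measure \<iota> K)"
    by (intro prob_spaceI) (simp add: mc_measure_def space_PiM)
qed

lemma measure_mc_measure_cylinder:
  "measure (mc_measure \<iota> K) {\<omega>. \<forall>t\<le>n. \<omega> t = x t} =
     pmf \<iota> (x 0) * (\<Prod>t<n. pmf (K (x t)) (x (Suc t)))"
proof -
  interpret Ionescu_Tulcea "mc_kernel \<iota> K" "\<lambda>_. count_space UNIV"
    by (rule Ionescu_Tulcea_mc_kernel)
  let ?M = "\<lambda>_::nat. count_space (UNIV :: 'a set)"
  let ?u = "\<lambda>_::nat. undefined :: 'a"
  let ?X = "\<lambda>m. {restrict x {0..<m}}"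
  let ?p = "\<lambda>t. pmf (case t of 0 \<Rightarrow> \<iota> | Suc u \<Rightarrow> K (x u)) (x t)"
  have X_eq: "?X m = PiE {0..<m} (\<lambda>i. {x i})" for m
    by (rule set_eqI) (auto simp: PiE_def extensional_def restrict_def fun_eq_iff Pi_iff)
  have X_sets: "?X m \<in> sets (PiM {0..<m} ?M)" for m
    unfolding X_eq by (intro sets_PiM_I_finite) auto
  have C: "emeasure (C 0 m ?u) (?X m) = ennreal (\<Prod>t<m. ?p t)" for m
  proof (induction m)
    case 0
    have "restrict x {0..<0} = ?u"
      by (simp add: fun_eq_iff)
    then show ?case
      by (simp add: sets_PiM_empty)
  next
    case (Suc m)
    have sp: "?u \<in> space (PiM {0..<0} ?M)"
      by (simp add: space_PiM)
    have "emeasure (C 0 (Suc m) ?u) (?X (Suc m)) =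
        (\<integral>\<^sup>+ \<omega>. emeasure (eP m \<omega>) (?X (Suc m)) \<partial>C 0 m ?u)"
      using X_sets[of "Suc m"] sp
      by (simp, subst emeasure_bind[where N="PiM {0..<Suc m} ?M"])
        (auto simp: space_C measurable_cong_sets[OF sets_C] space_PiM)
    also have "\<dots> = (\<integral>\<^sup>+ \<omega>. ennreal (?p m) * indicator (?X m) \<omega> \<partial>C 0 m ?u)"
    proof (rule nn_integral_cong)
      fix \<omega> assume "\<omega> \<in> space (C 0 m ?u)"
      then have w: "\<omega> \<in> space (PiM {0..<m} ?M)"
        using space_C[OF sp] by simp
      have eq: "fun_upd \<omega> m y = restrict x {0..<Suc m} \<longleftrightarrow> \<omega> = restrict x {0..<m} \<and> y = x m" for y
      proof
        assume a: "fun_upd \<omega> m y = restrict x {0..<Suc m}"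
        have "y = x m"
          using fun_cong[OF a, of m] by simp
        moreover have "\<omega> i = restrict x {0..<m} i" for i
          using fun_cong[OF a, of i] w
          by (cases "i = m") (auto simp: space_PiM PiE_def extensional_def restrict_def split: if_splits)
        ultimately show "\<omega> = restrict x {0..<m} \<and> y = x m"
          by auto
      next
        assume "\<omega> = restrict x {0..<m} \<and> y = x m"
        then show "fun_upd \<omega> m y = restrict x {0..<Suc m}"
          by (auto simp: fun_eq_iff)
      qed
      have "emeasure (eP m \<omega>) (?X (Suc m)) =
          emeasure (mc_kernel \<iota> K m \<omega>) {y. fun_upd \<omega> m y = restrict x {0..<Suc m}}"
        by (subst emeasure_eP[OF w X_sets]) (simp add: vimage_def)
      also have "\<dots> = ennreal (?p m) * indicator (?X m) \<omega>"
      proof (cases "\<omega> = restrict x {0..<m}")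
        case True
        then have "mc_kernel \<iota> K m \<omega> = measure_pmf (case m of 0 \<Rightarrow> \<iota> | Suc u \<Rightarrow> K (x u))"
          by (simp add: mc_kernel_def split: nat.split)
        then show ?thesis
          unfolding eq using True by (simp add: emeasure_pmf_single)
      qed (simp add: eq)
      finally show "emeasure (eP m \<omega>) (?X (Suc m)) = ennreal (?p m) * indicator (?X m) \<omega>" .
    qed
    also have "\<dots> = ennreal (?p m) * emeasure (C 0 m ?u) (?X m)"
      using X_sets[of m] sp by (intro nn_integral_cmult_indicator) (simp add: sets_C)
    also have "\<dots> = ennreal (\<Prod>t<Suc m. ?p t)"
      unfolding Suc.IH by (simp add: ennreal_mult'[symmetric] mult.commute)
    finally show ?case .
  qed
  have cyl: "{\<omega>. \<forall>t\<le>n. \<omega> t = x t} = PF.emb UNIV {0..<Suc n} (?X (Suc n))"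
    unfolding X_eq
    by (auto simp: prod_emb_def space_PiM PiE_iff less_Suc_eq_le)
  have "emeasure (mc_measure \<iota> K) {\<omega>. \<forall>t\<le>n. \<omega> t = x t} =
      emeasure (CI {0..<Suc n}) (?X (Suc n))"
    unfolding cyl mc_measure_def by (rule lim) (auto intro: X_sets)
  also have "\<dots> = emeasure (C 0 (Suc n) ?u) (PF.emb {0..<Suc n} {0..<Suc n} (?X (Suc n)))"
    by (rule emeasure_CI) (auto intro: X_sets)
  also have "PF.emb {0..<Suc n} {0..<Suc n} (?X (Suc n)) = ?X (Suc n)"
    using sets.sets_into_space[OF X_sets[of "Suc n"]] by (intro prod_emb_id) (auto simp: space_PiM)
  finally have "emeasure (mc_measure \<iota> K) {\<omega>. \<forall>t\<le>n. \<omega> t = x t} = ennreal (\<Prod>t<Suc n. ?p t)"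
    unfolding C .
  then have "measure (mc_measure \<iota> K) {\<omega>. \<forall>t\<le>n. \<omega> t = x t} = (\<Prod>t<Suc n. ?p t)"
    by (simp add: measure_def prod_nonneg)
  then show ?thesis
    by (simp add: prod.lessThan_Suc_shift del: prod.lessThan_Suc)
qed

section \<open>Markov decision processes and schedulers\<close>

text \<open>
  The set of actions is the finite type \<open>'a\<close>; the labels are of an arbitrary type \<open>'l\<close>, which is
  \<open>'ap set\<close> for the given MDP.
\<close>

record ('s, 'a, 'l) mdp =
  states :: "'s set"
  tprob :: "'s \<Rightarrow> 'a \<Rightarrow> 's \<Rightarrow> real"
  iprob :: "'s \<Rightarrow> real"
  label :: "'s \<Rightarrow> 'l"

definition enabled :: "('s, 'a, 'l) mdp \<Rightarrow> 's \<Rightarrow> 'a \<Rightarrow> bool" where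
  "enabled M s a \<longleftrightarrow> (\<Sum>s'\<in>states M. tprob M s a s') = 1"

text \<open>
  The last two conjuncts only fix the values of the total functions \<^term>\<open>tprob M\<close> and
  \<^term>\<open>iprob M\<close> outside the state space.
\<close>

definition mdp :: "('s, 'a, 'l) mdp \<Rightarrow> bool" where
  "mdp M \<longleftrightarrow>
     finite (states M) \<and>
     (\<forall>s\<in>states M. \<forall>a. \<forall>s'\<in>states M. 0 \<le> tprob M s a s' \<and> tprob M s a s' \<le> 1) \<and>
     (\<forall>s\<in>states M. \<forall>a. (\<Sum>s'\<in>states M. tprob M s a s') \<in> {0, 1}) \<and>
     (\<forall>s\<in>states M. 0 \<le> iprob M s) \<and>
     (\<Sum>s\<in>states M. iprob M s) = 1 \<and>
     (\<forall>s a s'. s \<notin> states M \<or> s' \<notin> states M \<longrightarrow> tprob M s a s' = 0) \<and>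
     (\<forall>s. s \<notin> states M \<longrightarrow> iprob M s = 0)"

text \<open>The history \<open>s\<^sub>0 a\<^sub>0 s\<^sub>1 a\<^sub>1 \<dots> s\<^sub>m\<close> is encoded as \<open>([(s\<^sub>0,a\<^sub>0), (s\<^sub>1,a\<^sub>1), \<dots>], s\<^sub>m)\<close>.\<close>

type_synonym ('s, 'a) history = "('s \<times> 'a) list \<times> 's"
type_synonym ('s, 'a) scheduler = "('s, 'a) history \<Rightarrow> 'a pmf"

definition Sched :: "('s, 'a, 'l) mdp \<Rightarrow> ('s, 'a) scheduler set" where
  "Sched M = {\<SS>. \<forall>h s. fst ` set h \<subseteq> states M \<and> s \<in> states M \<longrightarrow>
                 (\<forall>a\<in>set_pmf (\<SS> (h, s)). enabled M s a)}"

text \<open>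
  The Markov chain induced by a scheduler. Along every history of positive probability
  \<^const>\<open>embed_pmf\<close> is applied only to functions that sum up to one.
\<close>

definition hist_init :: "('s, 'a, 'l) mdp \<Rightarrow> ('s, 'a) history pmf" where
  "hist_init M = map_pmf (\<lambda>s. ([], s)) (embed_pmf (iprob M))"

definition hist_step :: "('s, 'a, 'l) mdp \<Rightarrow> ('s, 'a) scheduler \<Rightarrow>
    ('s, 'a) history \<Rightarrow> ('s, 'a) history pmf" where
  "hist_step M \<SS> = (\<lambda>(h, s).
     bind_pmf (\<SS> (h, s)) (\<lambda>a.
       map_pmf (\<lambda>s'. (h @ [(s, a)], s')) (embed_pmf (tprob M s a))))"

definition path_measure :: "('s, 'a, 'l) mdp \<Rightarrow> ('s, 'a) scheduler \<Rightarrow>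
    (nat \<Rightarrow> ('s, 'a) history) measure" where
  "path_measure M \<SS> = mc_measure (hist_init M) (hist_step M \<SS>)"

definition state_seq :: "(nat \<Rightarrow> ('s, 'a) history) \<Rightarrow> nat \<Rightarrow> 's" where
  "state_seq \<omega> t = snd (\<omega> t)"

definition paths :: "('s, 'a, 'l) mdp \<Rightarrow> ('s, 'a) scheduler \<Rightarrow> (nat \<Rightarrow> 's) set" where
  "paths M \<SS> = state_seq ` {\<omega>. mc_path (hist_init M) (hist_step M \<SS>) \<omega>}"

section \<open>Self-composition\<close>

text \<open>Tuples indexed by \<open>1, \<dots>, n\<close> are functions on a finite index type \<open>'n\<close>.\<close>

definition self_comp :: "('s, 'a, 'l) mdp \<Rightarrow> ('n::finite \<Rightarrow> 's, 'n \<Rightarrow> 'a, 'n \<Rightarrow> 'l) mdp" where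
  "self_comp M =
     \<lparr> states = {f. \<forall>i. f i \<in> states M},
       tprob = (\<lambda>f a f'. \<Prod>i\<in>UNIV. tprob M (f i) (a i) (f' i)),
       iprob = (\<lambda>f. if \<exists>s. f = (\<lambda>_. s) then iprob M (THE s. f = (\<lambda>_. s)) else 0),
       label = (\<lambda>f i. label M (f i)) \<rparr>"

definition proj_history :: "'n \<Rightarrow> ('n \<Rightarrow> 's, 'n \<Rightarrow> 'a) history \<Rightarrow> ('s, 'a) history" where
  "proj_history i = (\<lambda>(h, f). (map (\<lambda>(g, a). (g i, a i)) h, f i))"

text \<open>As the product is over \<^term>\<open>UNIV\<close>, the default value passed to \<^const>\<open>Pi_pmf\<close> is irrelevant.\<close>

definition par_sched :: "('n::finite \<Rightarrow> ('s, 'a) scheduler) \<Rightarrow> ('n \<Rightarrow> 's, 'n \<Rightarrow> 'a) scheduler" where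
  "par_sched \<SS> h = Pi_pmf UNIV undefined (\<lambda>i. \<SS> i (proj_history i h))"

section \<open>Linear temporal logic and PHL formulas\<close>

datatype 'p ltl =
    LTrue
  | LProp 'p
  | LNot "'p ltl"
  | LAnd "'p ltl" "'p ltl"
  | LNext "'p ltl"
  | LUntil "'p ltl" "'p ltl"

primrec ltl_sat :: "(nat \<Rightarrow> 'p set) \<Rightarrow> 'p ltl \<Rightarrow> bool" where
  "ltl_sat w LTrue \<longleftrightarrow> True"
| "ltl_sat w (LProp p) \<longleftrightarrow> p \<in> w 0"
| "ltl_sat w (LNot \<phi>) \<longleftrightarrow> \<not> ltl_sat w \<phi>"
| "ltl_sat w (LAnd \<phi> \<psi>) \<longleftrightarrow> ltl_sat w \<phi> \<and> ltl_sat w \<psi>"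
| "ltl_sat w (LNext \<phi>) \<longleftrightarrow> ltl_sat (\<lambda>t. w (Suc t)) \<phi>"
| "ltl_sat w (LUntil \<phi> \<psi>) \<longleftrightarrow>
     (\<exists>u. ltl_sat (\<lambda>t. w (t + u)) \<psi> \<and> (\<forall>v<u. ltl_sat (\<lambda>t. w (t + v)) \<phi>))"

text \<open>
  The formula
  \<open>\<forall>\<sigma>\<^sub>1 \<dots> \<forall>\<sigma>\<^sub>n. ((\<forall>\<pi>\<^sub>1:\<sigma>\<^sub>1 \<dots> \<forall>\<pi>\<^sub>n:\<sigma>\<^sub>n. \<psi>) \<longrightarrow> (\<Sum>i. c\<^sub>i \<cdot> \<P>(\<phi>\<^sub>i)) \<bowtie> c)\<close> is represented by \<open>\<psi>\<close>
  (\<open>psi\<close>), the \<open>c\<^sub>i\<close> (\<open>coef\<close>), the \<open>\<phi>\<^sub>i\<close> (\<open>phi\<close>), \<open>\<bowtie>\<close> (\<open>cmp\<close>) and \<open>c\<close> (\<open>bound\<close>). The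
  atom \<open>(a, j)\<close> stands for \<open>a\<close> indexed by \<open>\<pi>\<^sub>j\<close> in \<open>\<psi>\<close> and for \<open>a\<close> indexed by \<open>\<sigma>\<^sub>j\<close> in the \<open>\<phi>\<^sub>i\<close>.
\<close>

record ('ap, 'n, 'k) phl =
  psi :: "('ap \<times> 'n) ltl"
  coef :: "'k \<Rightarrow> real"
  phi :: "'k \<Rightarrow> ('ap \<times> 'n) ltl"
  cmp :: "real \<Rightarrow> real \<Rightarrow> bool"
  bound :: real

definition atoms :: "('n \<Rightarrow> 'ap set) \<Rightarrow> ('ap \<times> 'n) set" where
  "atoms l = {(a, j). a \<in> l j}"

definition psi_sat :: "('s, 'a, 'ap set) mdp \<Rightarrow> ('n \<Rightarrow> nat \<Rightarrow> 's) \<Rightarrow> ('ap \<times> 'n) ltl \<Rightarrow> bool" where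
  "psi_sat M \<rho> \<psi> \<longleftrightarrow> ltl_sat (\<lambda>t. atoms (\<lambda>i. label M (\<rho> i t))) \<psi>"

definition ltl_prob :: "('s, 'a, 'n \<Rightarrow> 'ap set) mdp \<Rightarrow> ('s, 'a) scheduler \<Rightarrow> ('ap \<times> 'n) ltl \<Rightarrow> real"
  where
  "ltl_prob N \<SS> \<phi> =
     measure (path_measure N \<SS>)
       {\<omega> \<in> space (path_measure N \<SS>). ltl_sat (\<lambda>t. atoms (label N (state_seq \<omega> t))) \<phi>}"

definition phl_models :: "('s, 'a, 'ap set) mdp \<Rightarrow> ('ap, 'n::finite, 'k::finite) phl \<Rightarrow> bool"
    (infix \<open>\<Turnstile>\<close> 50) where
  "M \<Turnstile> \<Phi> \<longleftrightarrow>
     (\<forall>\<SS> :: 'n \<Rightarrow> ('s, 'a) scheduler. (\<forall>i. \<SS> i \<in> Sched M) \<longrightarrow>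
        (\<forall>\<rho>. (\<forall>i. \<rho> i \<in> paths M (\<SS> i)) \<longrightarrow> psi_sat M \<rho> (psi \<Phi>)) \<longrightarrow>
        cmp \<Phi> (\<Sum>i\<in>UNIV. coef \<Phi> i * ltl_prob (self_comp M) (par_sched \<SS>) (phi \<Phi> i)) (bound \<Phi>))"

section \<open>Automata\<close>

record ('q, 'l) dsa =
  sstates :: "'q set"
  sinit :: 'q
  sdelta :: "'q \<Rightarrow> 'l \<Rightarrow> 'q option"

definition dsa :: "'l set \<Rightarrow> ('q, 'l) dsa \<Rightarrow> bool" where
  "dsa \<Sigma> D \<longleftrightarrow>
     finite (sstates D) \<and> sinit D \<in> sstates D \<and>
     (\<forall>q\<in>sstates D. \<forall>l\<in>\<Sigma>. \<forall>q'. sdelta D q l = Some q' \<longrightarrow> q' \<in> sstates D)"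

definition dsa_accepts :: "('q, 'l) dsa \<Rightarrow> (nat \<Rightarrow> 'l) \<Rightarrow> bool" where
  "dsa_accepts D w \<longleftrightarrow>
     (\<exists>r. r 0 = sinit D \<and> (\<forall>t. sdelta D (r t) (w t) = Some (r (Suc t))))"

record ('r, 'l) dra =
  rstates :: "'r set"
  rinit :: 'r
  rdelta :: "'r \<Rightarrow> 'l \<Rightarrow> 'r"
  rpairs :: "('r set \<times> 'r set) list"

definition dra :: "('r, 'l) dra \<Rightarrow> bool" where
  "dra A \<longleftrightarrow>
     finite (rstates A) \<and> rinit A \<in> rstates A \<and>
     (\<forall>q\<in>rstates A. \<forall>l. rdelta A q l \<in> rstates A) \<and>
     (\<forall>(B, G)\<in>set (rpairs A). B \<subseteq> rstates A \<and> G \<subseteq> rstates A)"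

primrec dra_run :: "('r, 'l) dra \<Rightarrow> (nat \<Rightarrow> 'l) \<Rightarrow> nat \<Rightarrow> 'r" where
  "dra_run A w 0 = rinit A"
| "dra_run A w (Suc t) = rdelta A (dra_run A w t) (w t)"

definition dra_accepts :: "('r, 'l) dra \<Rightarrow> (nat \<Rightarrow> 'l) \<Rightarrow> bool" where
  "dra_accepts A w \<longleftrightarrow>
     (\<exists>(B, G)\<in>set (rpairs A). finite {t. dra_run A w t \<in> B} \<and> infinite {t. dra_run A w t \<in> G})"

section \<open>The product constructions\<close>

text \<open>
  \<open>kept M k\<close> is the set of states that survive \<open>k\<close> rounds of removing the states without enabled
  actions together with all actions that may then leave the remaining states.
\<close>

primrec kept :: "('s, 'a, 'l) mdp \<Rightarrow> nat \<Rightarrow> 's set" where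
  "kept M 0 = states M"
| "kept M (Suc k) = {s \<in> kept M k. \<exists>a. (\<Sum>s'\<in>kept M k. tprob M s a s') = 1}"

definition prune :: "('s, 'a, 'l) mdp \<Rightarrow> ('s, 'a, 'l) mdp" where
  "prune M = (let V = (\<Inter>k. kept M k) in
     \<lparr> states = V,
       tprob = (\<lambda>s a s'. if s \<in> V \<and> s' \<in> V \<and> (\<Sum>u\<in>V. tprob M s a u) = 1
                         then tprob M s a s' else 0),
       iprob = (\<lambda>s. if s \<in> V then iprob M s else 0),
       label = label M \<rparr>)"

definition M_chi :: "('s, 'a, 'ap set) mdp \<Rightarrow> ('q, 'n::finite \<Rightarrow> 's) dsa \<Rightarrow>
    (('n \<Rightarrow> 's) \<times> 'q, 'n \<Rightarrow> 'a, ('ap \<times> 'n) set) mdp" where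
  "M_chi M D = prune
     \<lparr> states = states (self_comp M) \<times> sstates D,
       tprob = (\<lambda>(s, q) a (s', q').
         if sdelta D q s' = Some q' then tprob (self_comp M) s a s' else 0),
       iprob = (\<lambda>(s, q). if sdelta D (sinit D) s = Some q then iprob (self_comp M) s else 0),
       label = (\<lambda>(s, q). {(a, j). a \<in> label M (s j)}) \<rparr>"

definition M_tilde :: "('v, 'b, 'l) mdp \<Rightarrow> ('k::finite \<Rightarrow> ('r, 'l) dra) \<Rightarrow>
    ('v \<times> ('k \<Rightarrow> 'r), 'b, 'l) mdp" where
  "M_tilde N A =
     \<lparr> states = states N \<times> {r. \<forall>i. r i \<in> rstates (A i)},
       tprob = (\<lambda>(v, r) a (v', r').
         if \<forall>i. r' i = rdelta (A i) (r i) (label N v') then tprob N v a v' else 0),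
       iprob = (\<lambda>(v, r).
         if \<forall>i. r i = rdelta (A i) (rinit (A i)) (label N v) then iprob N v else 0),
       label = (\<lambda>(v, r). label N v) \<rparr>"

section \<open>End components and the linear program\<close>

definition end_component :: "('s, 'a, 'l) mdp \<Rightarrow> 's set \<Rightarrow> bool" where
  "end_component M E \<longleftrightarrow> E \<noteq> {} \<and> E \<subseteq> states M \<and>
     (\<exists>Act. (\<forall>s\<in>E. Act s \<noteq> {} \<and>
               (\<forall>a\<in>Act s. enabled M s a \<and> {s' \<in> states M. tprob M s a s' > 0} \<subseteq> E)) \<and>
            (\<forall>s\<in>E. \<forall>t\<in>E.
               (s, t) \<in> {(u, v). u \<in> E \<and> v \<in> E \<and> (\<exists>a\<in>Act u. tprob M u a v > 0)}\<^sup>*))"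

definition success_set :: "('v \<times> ('k \<Rightarrow> 'r), 'b, 'l) mdp \<Rightarrow> ('k \<Rightarrow> ('r, 'l) dra) \<Rightarrow> 'k set \<Rightarrow>
    ('v \<times> ('k \<Rightarrow> 'r)) set" where
  "success_set N A I = \<Union> {E. end_component N E \<and>
     (\<forall>i\<in>I. \<exists>(B, G)\<in>set (rpairs (A i)).
        E \<inter> {s \<in> states N. snd s i \<in> B} = {} \<and> E \<inter> {s \<in> states N. snd s i \<in> G} \<noteq> {})}"

definition lp_feasible :: "('v \<times> ('k \<Rightarrow> 'r), 'b, 'l) mdp \<Rightarrow> ('k \<Rightarrow> ('r, 'l) dra) \<Rightarrow>
    ('k \<Rightarrow> real) \<Rightarrow> ('v \<times> ('k \<Rightarrow> 'r) \<Rightarrow> real) \<Rightarrow> bool" where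
  "lp_feasible N A c x \<longleftrightarrow>
     (\<forall>s\<in>states N. x s \<ge> 0) \<and>
     (\<forall>I. I \<noteq> {} \<longrightarrow> (\<forall>s\<in>success_set N A I. x s \<ge> (\<Sum>i\<in>I. c i))) \<and>
     (\<forall>s\<in>states N. \<forall>a. x s \<ge> (\<Sum>t\<in>states N. tprob N s a t * x t))"

definition lp_optimal :: "('v \<times> ('k \<Rightarrow> 'r), 'b, 'l) mdp \<Rightarrow> ('k \<Rightarrow> ('r, 'l) dra) \<Rightarrow>
    ('k \<Rightarrow> real) \<Rightarrow> ('v \<times> ('k \<Rightarrow> 'r) \<Rightarrow> real) \<Rightarrow> bool" where
  "lp_optimal N A c x \<longleftrightarrow> lp_feasible N A c x \<and>
     (\<forall>y. lp_feasible N A c y \<longrightarrow> (\<Sum>s\<in>states N. x s) \<le> (\<Sum>s\<in>states N. y s))"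

end

theory Submission
  imports Defs
begin

text \<open>
  Let the schedulers satisfy \<open>\<chi>\<close>. Every path of the self-composition under their parallel
  composition is then accepted by the safety automaton, so each finite history \<open>h\<close> determines a
  state \<open>obs h\<close> of the product MDP that survives the pruning, and the process \<open>obs (\<omega> t)\<close> moves
  according to the product's transition probabilities. Feasibility for the linear program makes
  \<open>x (obs (\<omega> t))\<close> a nonnegative supermartingale. Almost surely the states visited infinitely often
  form an end component, and the process eventually stays in it; there \<open>x\<close> is at least the total
  weight \<open>Y \<omega>\<close> of the formulas that hold on \<open>\<omega>\<close>. Hence Fatou's lemma gives
  \<open>E Y \<le> E (liminf x (obs (\<omega> t))) \<le> E (x (obs (\<omega> 0)))\<close>, which is the claimed bound; martingale
  convergence is not needed.
\<close>

section \<open>Supermartingales along paths of Markov chains\<close>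

text \<open>The schedulers are randomised and depend on the history, so the observed product state
  is not a Markov chain and the recurrence theory of finite chains does not apply to it. The work is
  done on the chain of histories; given the history and the chosen action, the next observation
  depends only on the current observation and that action. A state-action pair used infinitely often
  must then reach each of its possible successors infinitely often. The trials are neither
  independent nor at fixed times, hence a conditional form of Borel-Cantelli. It is what makes the
  visited set closed under the recurring actions. The premise of the formula speaks of all paths,
  not almost all. Every history of positive probability extends to an infinite path and so has an
  automaton run; therefore neither the partial transition function nor the pruning loses probability
  mass. The link with the linear program is pathwise: acceptance by a Rabin pair depends only on the
  visited set, so if I is the set of formulas true on a path and is nonempty, the visited set is one
  of the end components collected in the success set of I.\<close>

primrec path_pmf :: "'x pmf \<Rightarrow> ('x \<Rightarrow> 'x pmf) \<Rightarrow> nat \<Rightarrow> 'x list pmf" where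
  "path_pmf \<iota> K 0 = map_pmf (\<lambda>x. [x]) \<iota>"
| "path_pmf \<iota> K (Suc n) =
     bind_pmf (path_pmf \<iota> K n) (\<lambda>xs. map_pmf (\<lambda>y. xs @ [y]) (K (last xs)))"

lemma length_path_pmf: "xs \<in> set_pmf (path_pmf \<iota> K n) \<Longrightarrow> length xs = Suc n"
  by (induction n arbitrary: xs) auto

lemma path_pmf_Suc_iff:
  "xs @ [y] \<in> set_pmf (path_pmf \<iota> K (Suc n)) \<longleftrightarrow>
     xs \<in> set_pmf (path_pmf \<iota> K n) \<and> y \<in> set_pmf (K (last xs))"
  by auto

lemma pmf_path_pmf_snoc:
  "pmf (path_pmf \<iota> K (Suc n)) (xs @ [y]) = pmf (path_pmf \<iota> K n) xs * pmf (K (last xs)) y"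
proof -
  have "pmf (map_pmf (\<lambda>y. xs' @ [y]) (K (last xs'))) (xs @ [y]) =
      indicator {xs} xs' * pmf (K (last xs)) y" for xs'
  proof (cases "xs' = xs")
    case True
    then show ?thesis
      using pmf_map_inj'[of "\<lambda>y. xs @ [y]" "K (last xs)" y] by (simp add: inj_def)
  next
    case False
    then show ?thesis
      by (auto simp: pmf_eq_0_set_pmf)
  qed
  then show ?thesis
    by (simp add: pmf_bind measure_pmf_single)
qed

lemma pmf_path_pmf:
  "pmf (path_pmf \<iota> K n) (map x [0..<Suc n]) =
     pmf \<iota> (x 0) * (\<Prod>t<n. pmf (K (x t)) (x (Suc t)))"
proof (induction n)
  case 0
  show ?case
    using pmf_map_inj'[of "\<lambda>x. [x]" \<iota> "x 0"] by (simp add: inj_def)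
next
  case (Suc n)
  have "map x [0..<Suc (Suc n)] = map x [0..<Suc n] @ [x (Suc n)]" "last (map x [0..<Suc n]) = x n"
    by simp_all
  with Suc show ?case
    by (simp only: pmf_path_pmf_snoc prod.lessThan_Suc mult.assoc)
qed

section \<open>Cylinder sets and the law of a finite prefix\<close>

lemma measurable_mc_coordinate [measurable]:
  "(\<lambda>\<omega>. f (\<omega> t)) \<in> measurable (mc_measure \<iota> K) (count_space UNIV)"
proof -
  have "(\<lambda>\<omega>. \<omega> t) \<in> measurable (mc_measure \<iota> K) (count_space UNIV)"
    by (subst measurable_cong_sets[OF sets_mc_measure refl]) simp
  then show ?thesis
    by (rule measurable_compose) simp
qed

lemma map_upt_eq_iff:
  "length xs = Suc n \<Longrightarrow> map \<omega> [0..<Suc n] = xs \<longleftrightarrow> (\<forall>t\<le>n. \<omega> t = xs ! t)"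
  by (auto simp: list_eq_iff_nth_eq less_Suc_eq_le simp del: upt_Suc)

lemma cylinder_in_sets: 
  assumes "length xs = Suc n"
  shows "{\<omega>. map \<omega> [0..<Suc n] = xs} \<in> sets (mc_measure \<iota> K)"
proof -
  have "Measurable.pred (mc_measure \<iota> K) (\<lambda>\<omega>. \<forall>t\<in>{..n}. \<omega> t = xs ! t)"
    by (intro pred_intros_finite measurable_mc_coordinate[where f="\<lambda>y. y = xs ! _"]) simp
  then show ?thesis
    by (simp add: pred_def map_upt_eq_iff[OF assms] Ball_def del: upt_Suc)
qed

lemma emeasure_cylinder:
  assumes "length xs = Suc n"
  shows "emeasure (mc_measure \<iota> K) {\<omega>. map \<omega> [0..<Suc n] = xs} = ennreal (pmf (path_pmf \<iota> K n) xs)"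
proof -
  interpret prob_space "mc_measure \<iota> K"
    by (rule prob_space_mc_measure)
  have xs: "xs = map ((!) xs) [0..<Suc n]"
    using assms by (metis map_nth)
  show ?thesis
    unfolding map_upt_eq_iff[OF assms] emeasure_eq_measure measure_mc_measure_cylinder
    by (subst (3) xs) (simp only: pmf_path_pmf)
qed

lemma nn_integral_count_space_set_pmf:
  fixes f :: "'x \<Rightarrow> ennreal"
  shows "(\<integral>\<^sup>+x. f x * ennreal (pmf p x) \<partial>count_space (set_pmf p)) = (\<integral>\<^sup>+x. f x \<partial>p)"
  by (subst nn_integral_count_space_indicator)
     (auto simp: nn_integral_measure_pmf mult.commute indicator_def set_pmf_iff
       intro!: nn_integral_cong)

text \<open>Only countably many prefixes have positive probability; their cylinders are disjoint,
  and their masses add up to 1 because they are the weights of a pmf. Countability also makes the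
  union measurable.\<close>

lemma AE_prefix_in_path_pmf:
  "AE \<omega> in mc_measure \<iota> K. map \<omega> [0..<Suc n] \<in> set_pmf (path_pmf \<iota> K n)"
proof -
  interpret prob_space "mc_measure \<iota> K"
    by (rule prob_space_mc_measure)
  let ?P = "path_pmf \<iota> K n"
  let ?C = "\<lambda>xs. {\<omega> :: nat \<Rightarrow> 'a. map \<omega> [0..<Suc n] = xs}"
  have C: "?C xs \<in> events" if "xs \<in> set_pmf ?P" for xs
    using cylinder_in_sets length_path_pmf[OF that] by blast
  have "emeasure (mc_measure \<iota> K) (\<Union>xs\<in>set_pmf ?P. ?C xs) =
      (\<integral>\<^sup>+xs. emeasure (mc_measure \<iota> K) (?C xs) \<partial>count_space (set_pmf ?P))"
    by (rule emeasure_UN_countable) (auto simp: C disjoint_family_on_def simp del: upt_Suc)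
  also have "\<dots> = (\<integral>\<^sup>+xs. pmf ?P xs \<partial>count_space (set_pmf ?P))"
    by (rule nn_integral_cong) (simp add: emeasure_cylinder length_path_pmf del: upt_Suc)
  also have "\<dots> = (\<integral>\<^sup>+xs. 1 \<partial>measure_pmf ?P)"
    using nn_integral_count_space_set_pmf[where f="\<lambda>_. 1" and p="?P"] by simp
  finally have "emeasure (mc_measure \<iota> K) (\<Union>xs\<in>set_pmf ?P. ?C xs) = 1"
    by (simp add: measure_pmf.emeasure_space_1[simplified])
  then have "AE \<omega> in mc_measure \<iota> K. \<omega> \<in> (\<Union>xs\<in>set_pmf ?P. ?C xs)"
    using C by (subst AE_in_set_eq_1) (auto simp: emeasure_eq_measure simp del: upt_Suc)
  then show ?thesis
    by eventually_elim auto
qed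

lemma AE_mc_path: "AE \<omega> in mc_measure \<iota> K. mc_path \<iota> K \<omega>"
proof -
  have "AE \<omega> in mc_measure \<iota> K. \<forall>n. map \<omega> [0..<Suc n] \<in> set_pmf (path_pmf \<iota> K n)"
    by (subst AE_all_countable) (intro allI AE_prefix_in_path_pmf)
  then show ?thesis
  proof eventually_elim
    case (elim \<omega>)
    have "\<omega> (Suc t) \<in> set_pmf (K (\<omega> t))" for t
    proof -
      have "map \<omega> [0..<Suc t] @ [\<omega> (Suc t)] \<in> set_pmf (path_pmf \<iota> K (Suc t))"
        using elim[rule_format, of "Suc t"] by simp
      then show ?thesis
        unfolding path_pmf_Suc_iff by simp
    qed
    moreover have "\<omega> 0 \<in> set_pmf \<iota>"
      using elim[rule_format, of 0] by auto
    ultimately show ?case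
      by (simp add: mc_path_def)
  qed
qed

text \<open>The state type may be uncountable, and a function of several coordinates is then not
  automatically measurable; \<open>F\<close> therefore comes with that hypothesis.\<close>

lemma nn_integral_prefix:
  assumes F: "(\<lambda>\<omega>. F (map \<omega> [0..<Suc n])) \<in> borel_measurable (mc_measure \<iota> K)"
  shows "(\<integral>\<^sup>+\<omega>. F (map \<omega> [0..<Suc n]) \<partial>mc_measure \<iota> K) = (\<integral>\<^sup>+xs. F xs \<partial>path_pmf \<iota> K n)"
proof -
  let ?P = "path_pmf \<iota> K n" and ?M = "mc_measure \<iota> K"
  let ?C = "\<lambda>xs. {\<omega> :: nat \<Rightarrow> 'a. map \<omega> [0..<Suc n] = xs}"
  have "(\<integral>\<^sup>+\<omega>. F (map \<omega> [0..<Suc n]) \<partial>?M) =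
      (\<integral>\<^sup>+\<omega>. (\<integral>\<^sup>+xs. F xs * indicator (?C xs) \<omega> \<partial>count_space (set_pmf ?P)) \<partial>?M)"
  proof (rule nn_integral_cong_AE)
    show "AE \<omega> in ?M. F (map \<omega> [0..<Suc n]) =
        (\<integral>\<^sup>+xs. F xs * indicator (?C xs) \<omega> \<partial>count_space (set_pmf ?P))"
      using AE_prefix_in_path_pmf[of n \<iota> K]
    proof eventually_elim
      case (elim \<omega>)
      let ?w = "map \<omega> [0..<Suc n]"
      have "(\<integral>\<^sup>+xs. F xs * indicator (?C xs) \<omega> \<partial>count_space (set_pmf ?P)) =
          (\<integral>\<^sup>+xs. F ?w * indicator {?w} xs \<partial>count_space (set_pmf ?P))"
        by (rule nn_integral_cong) (auto simp: indicator_def simp del: upt_Suc)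
      also have "\<dots> = F ?w"
        using elim by (subst nn_integral_cmult_indicator) (auto simp del: upt_Suc)
      finally show ?case by simp
    qed
  qed
  \<comment> \<open>Almost surely the integrand is a countable sum of constants times cylinder
    indicators, so the two integrals may be exchanged.\<close>
  also have "\<dots> = (\<integral>\<^sup>+xs. (\<integral>\<^sup>+\<omega>. F xs * indicator (?C xs) \<omega> \<partial>?M) \<partial>count_space (set_pmf ?P))"
    by (rule nn_integral_count_space_nn_integral)
       (auto intro!: borel_measurable_times_ennreal borel_measurable_indicator
          cylinder_in_sets length_path_pmf simp del: upt_Suc)
  also have "\<dots> = (\<integral>\<^sup>+xs. F xs * pmf ?P xs \<partial>count_space (set_pmf ?P))"
    by (rule nn_integral_cong)
       (simp add: nn_integral_cmult_indicator cylinder_in_sets emeasure_cylinder length_path_pmf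
          del: upt_Suc)
  also have "\<dots> = (\<integral>\<^sup>+xs. F xs \<partial>?P)"
    by (rule nn_integral_count_space_set_pmf)
  finally show ?thesis .
qed

text \<open>Hypotheses on a kernel are imposed only at these states: off them a history chain may
  take steps without meaning. Infinite paths are used because the safety premise speaks of
  them.\<close>

definition mc_reach :: "'x pmf \<Rightarrow> ('x \<Rightarrow> 'x pmf) \<Rightarrow> 'x \<Rightarrow> bool" where
  "mc_reach \<iota> K x \<longleftrightarrow> (\<exists>\<omega> t. mc_path \<iota> K \<omega> \<and> \<omega> t = x)"

text \<open>The support of a pmf is never empty, so a finite path never gets stuck.\<close>

lemma mc_path_extend:
  assumes "\<And>t. t < n \<Longrightarrow> \<omega> (Suc t) \<in> set_pmf (K (\<omega> t))" and "\<omega> 0 \<in> set_pmf \<iota>"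
  shows "\<exists>\<omega>'. mc_path \<iota> K \<omega>' \<and> (\<forall>t\<le>n. \<omega>' t = \<omega> t)"
proof -
  define \<eta> where "\<eta> = rec_nat (\<omega> n) (\<lambda>_ y. SOME z. z \<in> set_pmf (K y))"
  have \<eta>0: "\<eta> 0 = \<omega> n" and \<eta>: "\<eta> (Suc t) \<in> set_pmf (K (\<eta> t))" for t
    by (simp_all add: \<eta>_def some_in_eq set_pmf_not_empty)
  define \<omega>' where "\<omega>' t = (if t \<le> n then \<omega> t else \<eta> (t - n))" for t
  have "\<omega>' (Suc t) \<in> set_pmf (K (\<omega>' t))" for t
  proof (cases "t < n")
    case False
    then show ?thesis
      using \<eta>[of "t - n"] \<eta>0 by (auto simp: \<omega>'_def Suc_diff_le)
  qed (use assms in \<open>auto simp: \<omega>'_def\<close>)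
  then have "mc_path \<iota> K \<omega>'"
    using assms by (simp add: mc_path_def \<omega>'_def)
  then show ?thesis
    by (auto simp: \<omega>'_def)
qed

text \<open>The path through x is redirected to y after time t and extended again. Facts about
  consecutive positions of a path thereby become facts about one step of the kernel.\<close>

lemma mc_reach_step:
  assumes "mc_reach \<iota> K x" "y \<in> set_pmf (K x)"
  shows "\<exists>\<omega> t. mc_path \<iota> K \<omega> \<and> \<omega> t = x \<and> \<omega> (Suc t) = y"
proof -
  obtain \<omega> t where w: "mc_path \<iota> K \<omega>" "\<omega> t = x"
    using assms by (auto simp: mc_reach_def)
  have "\<exists>\<omega>'. mc_path \<iota> K \<omega>' \<and> (\<forall>u\<le>Suc t. \<omega>' u = (fun_upd \<omega> (Suc t) y) u)"
    using w assms by (intro mc_path_extend) (auto simp: mc_path_def less_Suc_eq)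
  then obtain \<omega>' where w': "mc_path \<iota> K \<omega>'" "\<forall>u\<le>Suc t. \<omega>' u = (fun_upd \<omega> (Suc t) y) u"
    by blast
  have "\<omega>' t = x" "\<omega>' (Suc t) = y"
    using w w'(2)[rule_format, of t] w'(2)[rule_format, of "Suc t"] by auto
  with w' show ?thesis
    by blast
qed

lemma mc_reach_closed: "mc_reach \<iota> K x \<Longrightarrow> y \<in> set_pmf (K x) \<Longrightarrow> mc_reach \<iota> K y"
  using mc_reach_step by (fastforce simp: mc_reach_def)

lemma mc_reach_init: "x \<in> set_pmf \<iota> \<Longrightarrow> mc_reach \<iota> K x"
  using mc_path_extend[of 0 "\<lambda>_. x" K \<iota>] by (auto simp: mc_reach_def)

lemma mc_reach_path_pmf:
  "xs \<in> set_pmf (path_pmf \<iota> K n) \<Longrightarrow> mc_reach \<iota> K (last xs)"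
proof (induction n arbitrary: xs)
  case (Suc n)
  then show ?case
    using mc_reach_step by (fastforce simp: mc_reach_def)
qed (auto intro: mc_reach_init)

text \<open>\<open>F\<close> depends on the whole prefix, not just on the last state, because the
  products in \<open>AE_infinitely_often\<close> do.\<close>

lemma supermartingale_prefix_le:
  assumes "\<And>n. (\<lambda>\<omega>. F (map \<omega> [0..<Suc n])) \<in> borel_measurable (mc_measure \<iota> K)"
    and step: "\<And>xs. xs \<noteq> [] \<Longrightarrow> mc_reach \<iota> K (last xs) \<Longrightarrow> (\<integral>\<^sup>+y. F (xs @ [y]) \<partial>K (last xs)) \<le> F xs"
  shows "(\<integral>\<^sup>+\<omega>. F (map \<omega> [0..<Suc n]) \<partial>mc_measure \<iota> K) \<le> (\<integral>\<^sup>+y. F [y] \<partial>\<iota>)"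
proof -
  have "(\<integral>\<^sup>+xs. F xs \<partial>path_pmf \<iota> K n) \<le> (\<integral>\<^sup>+y. F [y] \<partial>\<iota>)"
  proof (induction n)
    case 0
    show ?case by simp
  next
    case (Suc n)
    have "(\<integral>\<^sup>+xs. F xs \<partial>path_pmf \<iota> K (Suc n)) =
        (\<integral>\<^sup>+xs. (\<integral>\<^sup>+y. F (xs @ [y]) \<partial>K (last xs)) \<partial>path_pmf \<iota> K n)"
      by simp
    also have "\<dots> \<le> (\<integral>\<^sup>+xs. F xs \<partial>path_pmf \<iota> K n)"
      by (intro nn_integral_mono_AE, subst AE_measure_pmf_iff)
         (use length_path_pmf mc_reach_path_pmf in \<open>fastforce intro!: step\<close>)
    finally show ?case
      using Suc.IH by simp
  qed
  then show ?thesis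
    by (simp only: nn_integral_prefix[OF assms(1)])
qed

lemma supermartingale_liminf_le:
  assumes meas: "\<And>n. (\<lambda>\<omega>. F (map \<omega> [0..<Suc n])) \<in> borel_measurable (mc_measure \<iota> K)"
    and step: "\<And>xs. xs \<noteq> [] \<Longrightarrow> mc_reach \<iota> K (last xs) \<Longrightarrow> (\<integral>\<^sup>+y. F (xs @ [y]) \<partial>K (last xs)) \<le> F xs"
  shows "(\<integral>\<^sup>+\<omega>. liminf (\<lambda>n. F (map \<omega> [0..<Suc n])) \<partial>mc_measure \<iota> K) \<le> (\<integral>\<^sup>+y. F [y] \<partial>\<iota>)"
proof -
  have "(\<integral>\<^sup>+\<omega>. liminf (\<lambda>n. F (map \<omega> [0..<Suc n])) \<partial>mc_measure \<iota> K) \<le>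
      liminf (\<lambda>n. \<integral>\<^sup>+\<omega>. F (map \<omega> [0..<Suc n]) \<partial>mc_measure \<iota> K)"
    by (rule nn_integral_liminf) (rule meas)
  also have "\<dots> \<le> (\<integral>\<^sup>+y. F [y] \<partial>\<iota>)"
    by (intro Liminf_le eventuallyI supermartingale_prefix_le meas step) auto
  finally show ?thesis .
qed

section \<open>Events that must recur: conditional Borel-Cantelli\<close>

lemma card_filter_upt_at_top:
  assumes "infinite {t. P t}"
  shows "filterlim (\<lambda>n. card {j \<in> {m..<n}. P j}) at_top sequentially"
  unfolding filterlim_at_top
proof
  fix c :: nat
  have "infinite {t. m \<le> t \<and> P t}"
  proof
    assume "finite {t. m \<le> t \<and> P t}"
    then have "finite ({t. m \<le> t \<and> P t} \<union> {..<m})"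
      by simp
    then have "finite {t. P t}"
      by (rule rev_finite_subset) auto
    with assms show False by simp
  qed
  then obtain B where B: "finite B" "card B = c" "B \<subseteq> {t. m \<le> t \<and> P t}"
    by (metis infinite_arbitrarily_large)
  obtain b where b: "\<forall>j\<in>B. j < b"
    using B(1) finite_nat_set_iff_bounded by blast
  have "c \<le> card {j \<in> {m..<n}. P j}" if "n \<ge> b" for n
    unfolding B(2)[symmetric] using B b that by (intro card_mono) force+
  then show "\<forall>\<^sub>F n in sequentially. c \<le> card {j \<in> {m..<n}. P j}"
    using eventually_sequentially by blast
qed

text \<open>A conditional Borel--Cantelli lemma. With \<open>f = 1\<close> off \<open>Q\<close>, \<open>f = 0\<close> on \<open>Q \<inter> V\<close> and
  \<open>f = 1 + p\<close> on \<open>Q - V\<close>, the products of the \<open>f (\<omega> j)\<close> form a supermartingale, which diverges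
  on the paths that see \<open>Q\<close> infinitely often but \<open>Q \<inter> V\<close> only finitely often.\<close>

lemma AE_infinitely_often:
  fixes Q V :: "'x \<Rightarrow> bool"
  assumes "p > 0"
    and K: "\<And>x. mc_reach \<iota> K x \<Longrightarrow>
      p * measure (K x) {y. Q y} \<le> measure (K x) {y. Q y \<and> V y}"
  shows "AE \<omega> in mc_measure \<iota> K. infinite {t. Q (\<omega> t)} \<longrightarrow> infinite {t. Q (\<omega> t) \<and> V (\<omega> t)}"
proof -
  define f where "f y = (if Q y then if V y then 0 else 1 + p else 1)" for y
  have f0: "f y \<ge> 0" for y
    using \<open>p > 0\<close> by (simp add: f_def)
  \<comment> \<open>With a the probability of Q, the mean of \<open>f\<close> is at most (1 - a) +
    (1 + p)(1 - p) a = 1 - p^2 a. So a gain of p off V is paid for by losing everything on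
    V.\<close>
  have int_f: "(\<integral>\<^sup>+y. f y \<partial>K x) \<le> 1" if "mc_reach \<iota> K x" for x
  proof -
    let ?m = "measure (K x)"
    have "{y. \<not> Q y} = UNIV - {y. Q y}"
      by auto
    then have notQ: "?m {y. \<not> Q y} = 1 - ?m {y. Q y}"
      using measure_pmf.prob_compl[of "{y. Q y}" "K x"] by simp
    have "{y. Q y \<and> \<not> V y} = {y. Q y} - {y. Q y \<and> V y}"
      by auto
    then have QV: "?m {y. Q y \<and> \<not> V y} = ?m {y. Q y} - ?m {y. Q y \<and> V y}"
      by (simp only:) (rule measure_pmf.finite_measure_Diff, auto)
    have "(\<integral>\<^sup>+y. f y \<partial>K x) =
        (\<integral>\<^sup>+y. indicator {y. \<not> Q y} y + ennreal (1 + p) * indicator {y. Q y \<and> \<not> V y} y \<partial>K x)"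
      using \<open>p > 0\<close> by (intro nn_integral_cong) (auto simp: f_def)
    also have "\<dots> = ennreal (?m {y. \<not> Q y} + (1 + p) * ?m {y. Q y \<and> \<not> V y})"
      using \<open>p > 0\<close>
      by (simp add: nn_integral_add nn_integral_cmult measure_pmf.emeasure_eq_measure
          ennreal_mult'')
    also have "\<dots> \<le> 1"
    proof -
      let ?a = "?m {y. Q y}"
      have "?m {y. Q y \<and> \<not> V y} \<le> ?a - p * ?a"
        using QV K[OF that] by simp
      then have "(1 + p) * ?m {y. Q y \<and> \<not> V y} \<le> (1 + p) * (?a - p * ?a)"
        using \<open>p > 0\<close> by (intro mult_left_mono) auto
      also have "\<dots> = ?a - p * p * ?a"
        by (simp add: algebra_simps)
      also have "\<dots> \<le> ?a"
        by simp
      finally show ?thesis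
        using notQ by simp
    qed
    finally show ?thesis .
  qed
  \<comment> \<open>One visit to Q and V makes a product zero forever. Hence one product for each
    start m: on a bad path, m is taken beyond the last such visit.\<close>
  have bounded: "AE \<omega> in mc_measure \<iota> K. liminf (\<lambda>n. ennreal (\<Prod>j\<in>{Suc m..<Suc n}. f (\<omega> j))) \<noteq> \<infinity>" for m
  proof -
    define F where "F xs = ennreal (\<Prod>j\<in>{Suc m..<length xs}. f (xs ! j))" for xs
    have F_map: "F (map \<omega> [0..<Suc n]) = ennreal (\<Prod>j\<in>{Suc m..<Suc n}. f (\<omega> j))" for \<omega> n
      unfolding F_def length_map length_upt
      by (intro arg_cong[where f=ennreal] prod.cong) (auto simp del: upt_Suc)
    have meas[measurable]: "(\<lambda>\<omega>. F (map \<omega> [0..<Suc n])) \<in> borel_measurable (mc_measure \<iota> K)" for n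
      unfolding F_map by (intro measurable_compose[OF _ measurable_ennreal] borel_measurable_prod
          measurable_compose[OF measurable_mc_coordinate[where f="\<lambda>y. y"]]) auto
    have "(\<integral>\<^sup>+\<omega>. liminf (\<lambda>n. F (map \<omega> [0..<Suc n])) \<partial>mc_measure \<iota> K) \<le> (\<integral>\<^sup>+y. F [y] \<partial>\<iota>)"
    proof (rule supermartingale_liminf_le)
      fix xs :: "'x list" assume xs: "xs \<noteq> []" "mc_reach \<iota> K (last xs)"
      show "(\<integral>\<^sup>+y. F (xs @ [y]) \<partial>K (last xs)) \<le> F xs"
      proof (cases "Suc m \<le> length xs")
        case True
        have "(\<Prod>j\<in>{Suc m..<length xs}. f ((xs @ [y]) ! j)) = (\<Prod>j\<in>{Suc m..<length xs}. f (xs ! j))" for y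
          by (intro prod.cong) (auto simp: nth_append)
        then have "F (xs @ [y]) = F xs * ennreal (f y)" for y
          using True f0 by (simp add: F_def ennreal_mult'' prod_nonneg)
        then have "(\<integral>\<^sup>+y. F (xs @ [y]) \<partial>K (last xs)) = F xs * (\<integral>\<^sup>+y. f y \<partial>K (last xs))"
          by (simp add: nn_integral_cmult)
        also have "\<dots> \<le> F xs * 1"
          using int_f[OF xs(2)] by (intro mult_left_mono) auto
        finally show ?thesis by simp
      next
        \<comment> \<open>Both products are still empty here, hence 1.\<close>
        case False
        then show ?thesis
          by (simp add: F_def measure_pmf.emeasure_space_1[simplified])
      qed
    qed (rule meas)
    also have "\<dots> < \<infinity>"
      by (simp add: F_def measure_pmf.emeasure_space_1[simplified])
    finally have "AE \<omega> in mc_measure \<iota> K. liminf (\<lambda>n. F (map \<omega> [0..<Suc n])) \<noteq> \<infinity>"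
      by (intro nn_integral_PInf_AE borel_measurable_liminf meas) auto
    then show ?thesis
      unfolding F_map .
  qed
  have "AE \<omega> in mc_measure \<iota> K. \<forall>m. liminf (\<lambda>n. ennreal (\<Prod>j\<in>{Suc m..<Suc n}. f (\<omega> j))) \<noteq> \<infinity>"
    unfolding AE_all_countable using bounded by blast
  then show ?thesis
  proof eventually_elim
    case (elim \<omega>)
    show ?case
    proof (intro impI notI)
      assume Q: "infinite {t. Q (\<omega> t)}" and "finite {t. Q (\<omega> t) \<and> V (\<omega> t)}"
      then obtain m where m: "\<And>t. Q (\<omega> t) \<Longrightarrow> V (\<omega> t) \<Longrightarrow> t \<le> m"
        unfolding finite_nat_set_iff_bounded_le by blast
      \<comment> \<open>Past m no factor vanishes, and each visit to Q multiplies the product by 1 +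
        p.\<close>
      let ?c = "\<lambda>n. card {j \<in> {Suc m..<Suc n}. Q (\<omega> j)}"
      have "(\<Prod>j\<in>{Suc m..<Suc n}. f (\<omega> j)) = (1 + p) ^ ?c n" for n
      proof -
        have "(\<Prod>j\<in>{Suc m..<Suc n}. f (\<omega> j)) =
            (\<Prod>j\<in>{Suc m..<Suc n}. if Q (\<omega> j) then 1 + p else 1)"
          using m by (intro prod.cong) (fastforce simp: f_def)+
        then show ?thesis
          by (simp add: prod.If_cases Int_def del: prod.op_ivl_Suc)
      qed
      moreover have "filterlim (\<lambda>n. (1 + p) ^ ?c n) at_top sequentially"
      proof -
        have "filterlim (\<lambda>n. (1 + p) ^ n) at_top sequentially"
          using \<open>p > 0\<close>
          by (intro filterlim_at_infinity_imp_filterlim_at_top filterlim_realpow_sequentially_gt1) auto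
        moreover have "filterlim ?c at_top sequentially"
          by (rule filterlim_compose[OF card_filter_upt_at_top[OF Q] filterlim_Suc])
        ultimately show ?thesis
          by (rule filterlim_compose)
      qed
      ultimately have "((\<lambda>n. ennreal (\<Prod>j\<in>{Suc m..<Suc n}. f (\<omega> j))) \<longlongrightarrow> \<infinity>) sequentially"
        unfolding infinity_ennreal_def ennreal_tendsto_top_eq_at_top by presburger
      then have "liminf (\<lambda>n. ennreal (\<Prod>j\<in>{Suc m..<Suc n}. f (\<omega> j))) = \<infinity>"
        by (rule lim_imp_Liminf[OF sequentially_bot])
      with elim show False by blast
    qed
  qed
qed

section \<open>End components visited by a controlled process\<close>

text \<open>
  \<open>K\<close> is a chain whose states remember the past: \<open>act y\<close> is the action chosen in the step that led
  to \<open>y\<close>, and \<open>pre y\<close> the observation before that step.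
\<close>

locale mdp_observation =
  fixes N :: "('w, 'b::finite, 'l) mdp"
    and \<iota> :: "'x pmf" and K :: "'x \<Rightarrow> 'x pmf"
    and obs :: "'x \<Rightarrow> 'w" and pre :: "'x \<Rightarrow> 'w" and act :: "'x \<Rightarrow> 'b"
  assumes finite_states: "finite (states N)"
    and tprob_nonneg: "u \<in> states N \<Longrightarrow> v \<in> states N \<Longrightarrow> 0 \<le> tprob N u a v"
    and obs_states: "mc_reach \<iota> K x \<Longrightarrow> obs x \<in> states N"
    and pre_obs: "mc_reach \<iota> K x \<Longrightarrow> y \<in> set_pmf (K x) \<Longrightarrow> pre y = obs x"
    and transition: "mc_reach \<iota> K x \<Longrightarrow> v \<in> states N \<Longrightarrow>
      measure (K x) {y. act y = a \<and> obs y = v} = measure (K x) {y. act y = a} * tprob N (obs x) a v"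
begin

definition visited :: "(nat \<Rightarrow> 'x) \<Rightarrow> 'w set" where
  "visited \<omega> = {w. infinite {t. obs (\<omega> t) = w}}"

text \<open>Summing \<open>transition\<close> over all v leaves the mass of the action unchanged,
  since every successor is observed inside \<open>states N\<close>. That mass is positive and
  cancels.\<close>

lemma enabled_act:
  assumes x: "mc_reach \<iota> K x" and y: "y \<in> set_pmf (K x)"
  shows "enabled N (obs x) (act y)"
proof -
  let ?m = "measure (K x) {z. act z = act y}"
  have "?m * (\<Sum>v\<in>states N. tprob N (obs x) (act y) v) =
      (\<Sum>v\<in>states N. measure (K x) {z. act z = act y \<and> obs z = v})"
    by (simp add: transition[OF x] sum_distrib_left)
  also have "\<dots> = measure (K x) (\<Union>v\<in>states N. {z. act z = act y \<and> obs z = v})"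
    by (intro measure_pmf.finite_measure_finite_Union[symmetric])
       (auto simp: finite_states disjoint_family_on_def)
  also have "\<dots> = ?m"
    using obs_states[OF mc_reach_closed[OF x]]
    by (intro measure_pmf.finite_measure_eq_AE) (auto simp: AE_measure_pmf_iff)
  finally have "?m * (\<Sum>v\<in>states N. tprob N (obs x) (act y) v) = ?m" .
  moreover have "?m \<noteq> 0"
    using y by (auto simp: measure_pmf_zero_iff)
  ultimately show ?thesis
    by (simp add: enabled_def)
qed

lemma tprob_pos:
  assumes "mc_reach \<iota> K x" "y \<in> set_pmf (K x)"
  shows "tprob N (obs x) (act y) (obs y) > 0"
proof -
  have "0 < pmf (K x) y"
    using assms by (simp add: pmf_positive)
  also have "\<dots> \<le> measure (K x) {z. act z = act y \<and> obs z = obs y}"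
    unfolding measure_pmf_single[symmetric] by (rule measure_pmf.finite_measure_mono) auto
  also have "\<dots> = measure (K x) {z. act z = act y} * tprob N (obs x) (act y) (obs y)"
    using assms by (intro transition obs_states) (auto dest: mc_reach_closed)
  finally show ?thesis
    using measure_nonneg[of "measure_pmf (K x)" "{z. act z = act y}"]
    unfolding zero_less_mult_iff by linarith
qed

text \<open>Borel-Cantelli with p the transition probability itself. The pair (u, a) is tested one
  step late, through \<open>pre\<close> and \<open>act\<close>, because only the new history reveals
  the action; trial and outcome are then events about the same draw.\<close>

lemma AE_successor:
  assumes "tprob N u a v > 0" "v \<in> states N"
  shows "AE \<omega> in mc_measure \<iota> K. infinite {t. pre (\<omega> t) = u \<and> act (\<omega> t) = a} \<longrightarrow>
           infinite {t. (pre (\<omega> t) = u \<and> act (\<omega> t) = a) \<and> obs (\<omega> t) = v}"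
proof (rule AE_infinitely_often[OF assms(1), where Q="\<lambda>y. pre y = u \<and> act y = a" and V="\<lambda>y. obs y = v"])
  fix x assume x: "mc_reach \<iota> K x"
  show "tprob N u a v * measure (K x) {y. pre y = u \<and> act y = a}
      \<le> measure (K x) {y. (pre y = u \<and> act y = a) \<and> obs y = v}"
  proof (cases "obs x = u")
    case True
    have "measure (K x) {y. pre y = u \<and> act y = a} = measure (K x) {y. act y = a}"
      using x True by (intro measure_pmf.finite_measure_eq_AE) (auto simp: AE_measure_pmf_iff pre_obs)
    moreover have "measure (K x) {y. (pre y = u \<and> act y = a) \<and> obs y = v} =
        measure (K x) {y. act y = a \<and> obs y = v}"
      using x True by (intro measure_pmf.finite_measure_eq_AE) (auto simp: AE_measure_pmf_iff pre_obs)
    ultimately show ?thesis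
      using transition[OF x assms(2)] True by (simp add: mult.commute)
  next
    case False
    then have "measure (K x) {y. pre y = u \<and> act y = a} = 0"
      using x by (auto simp: measure_pmf_zero_iff pre_obs)
    then show ?thesis by simp
  qed
qed

text \<open>No probability is left here: \<open>succ\<close> isolates the only property that may
  fail on a null set, and the rest is a pigeonhole argument on one path with finitely many states
  and actions.\<close>

lemma end_component_visited:
  assumes path: "mc_path \<iota> K \<omega>"
    and succ: "\<And>u a v. v \<in> states N \<Longrightarrow> tprob N u a v > 0 \<Longrightarrow>
      infinite {t. pre (\<omega> t) = u \<and> act (\<omega> t) = a} \<Longrightarrow>
      infinite {t. (pre (\<omega> t) = u \<and> act (\<omega> t) = a) \<and> obs (\<omega> t) = v}"
  shows "end_component N (visited \<omega>)" "\<forall>\<^sub>F t in sequentially. obs (\<omega> t) \<in> visited \<omega>"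
proof -
  \<comment> \<open>The recurring actions are the action sets that witness the end
    component.\<close>
  define taken where "taken u = {a. infinite {t. obs (\<omega> t) = u \<and> act (\<omega> (Suc t)) = a}}" for u
  have reach: "mc_reach \<iota> K (\<omega> t)" for t
    using path by (auto simp: mc_reach_def)
  have step: "\<omega> (Suc t) \<in> set_pmf (K (\<omega> t))" for t
    using path by (simp add: mc_path_def)
  have obs: "obs (\<omega> t) \<in> states N" for t
    by (rule obs_states[OF reach])
  have pre: "pre (\<omega> (Suc t)) = obs (\<omega> t)" for t
    by (rule pre_obs[OF reach step])
  have sub: "visited \<omega> \<subseteq> states N"
  proof
    fix w assume "w \<in> visited \<omega>"
    then have "\<exists>t. obs (\<omega> t) = w"
      unfolding visited_def mem_Collect_eq infinite_nat_iff_unbounded_le by blast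
    then show "w \<in> states N"
      using obs by blast
  qed
  \<comment> \<open>\<open>pre\<close> and \<open>act\<close> look back, so occurrences at t
    reappear at t + 1.\<close>
  have inf_pre: "infinite {t. pre (\<omega> t) = u \<and> act (\<omega> t) = a}" if "a \<in> taken u" for u a
  proof -
    have "infinite (Suc ` {t. obs (\<omega> t) = u \<and> act (\<omega> (Suc t)) = a})"
      using that by (auto simp: taken_def finite_image_iff)
    then show ?thesis
      by (rule infinite_super[rotated]) (auto simp: pre)
  qed
  \<comment> \<open>There are finitely many states and state-action pairs; those occurring finitely
    often together account for finitely many times only.\<close>
  have ev: "\<forall>\<^sub>F t in sequentially. obs (\<omega> t) \<in> visited \<omega> \<and> act (\<omega> (Suc t)) \<in> taken (obs (\<omega> t))"
  proof -
    have "finite {t. obs (\<omega> t) = u \<and> act (\<omega> (Suc t)) = a}" if "a \<notin> taken u" for u a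
      using that by (simp add: taken_def)
    then have "finite (\<Union>(u, a) \<in> {(u, a). u \<in> states N \<and> a \<notin> taken u}.
        {t. obs (\<omega> t) = u \<and> act (\<omega> (Suc t)) = a})"
      using finite_subset[of "{(u, a). u \<in> states N \<and> a \<notin> taken u}" "states N \<times> UNIV"]
      by (intro finite_UN_I) (auto simp: finite_states)
    moreover have "finite (\<Union>u \<in> states N - visited \<omega>. {t. obs (\<omega> t) = u})"
      by (intro finite_UN_I) (auto simp: finite_states visited_def)
    ultimately have "finite ((\<Union>(u, a) \<in> {(u, a). u \<in> states N \<and> a \<notin> taken u}.
        {t. obs (\<omega> t) = u \<and> act (\<omega> (Suc t)) = a}) \<union> (\<Union>u \<in> states N - visited \<omega>. {t. obs (\<omega> t) = u}))"
      by simp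
    then have "finite {t. \<not> (obs (\<omega> t) \<in> visited \<omega> \<and> act (\<omega> (Suc t)) \<in> taken (obs (\<omega> t)))}"
      by (rule rev_finite_subset) (use obs in auto)
    then show ?thesis
      unfolding cofinite_eq_sequentially[symmetric] eventually_cofinite .
  qed
  then show ev': "\<forall>\<^sub>F t in sequentially. obs (\<omega> t) \<in> visited \<omega>"
    by eventually_elim auto
  obtain m where m: "\<And>t. t \<ge> m \<Longrightarrow> obs (\<omega> t) \<in> visited \<omega>"
      "\<And>t. t \<ge> m \<Longrightarrow> act (\<omega> (Suc t)) \<in> taken (obs (\<omega> t))"
    using ev unfolding eventually_sequentially by blast
  let ?R = "{(u, v). u \<in> visited \<omega> \<and> v \<in> visited \<omega> \<and> (\<exists>a\<in>taken u. tprob N u a v > 0)}"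
  \<comment> \<open>Past m each step of the path is itself an edge of the induced graph, so the path
    walks from any recurring state to any other.\<close>
  have R: "(obs (\<omega> t), obs (\<omega> (t + d))) \<in> ?R\<^sup>*" if "t \<ge> m" for t d
  proof (induction d)
    case (Suc d)
    have "(obs (\<omega> (t + d)), obs (\<omega> (t + Suc d))) \<in> ?R"
      unfolding add_Suc_right mem_Collect_eq case_prod_conv
      using that by (intro conjI bexI[where x="act (\<omega> (Suc (t + d)))"] m tprob_pos[OF reach step]) simp_all
    with Suc show ?case
      by (rule rtrancl_into_rtrancl)
  qed simp
  have recur: "\<exists>t\<ge>n. obs (\<omega> t) = u" if "u \<in> visited \<omega>" for u n
    using that by (auto simp: visited_def infinite_nat_iff_unbounded_le)
  have connected: "(u, v) \<in> ?R\<^sup>*" if u: "u \<in> visited \<omega>" and v: "v \<in> visited \<omega>" for u v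
  proof -
    obtain t where t: "t \<ge> m" "obs (\<omega> t) = u"
      using recur[OF u] by blast
    obtain d where d: "obs (\<omega> (t + d)) = v"
      using recur[OF v, of t] unfolding le_iff_add by blast
    show ?thesis
      using R[OF t(1), of d] unfolding t(2) d .
  qed
  have nonempty: "taken u \<noteq> {}" if u: "u \<in> visited \<omega>" for u
  proof -
    obtain t where t: "t \<ge> m" "obs (\<omega> t) = u"
      using recur[OF u] by blast
    then show ?thesis
      using m(2)[of t] by blast
  qed
  have enabled: "enabled N u a" if "a \<in> taken u" for u a
  proof -
    have "\<exists>t. obs (\<omega> t) = u \<and> act (\<omega> (Suc t)) = a"
      using that unfolding taken_def mem_Collect_eq infinite_nat_iff_unbounded_le by blast
    then show ?thesis
      using enabled_act[OF reach step] by blast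
  qed
  have closed: "v \<in> visited \<omega>" if "a \<in> taken u" "v \<in> states N" "tprob N u a v > 0" for u a v
    using infinite_super[OF _ succ[OF that(2,3) inf_pre[OF that(1)]], of "{t. obs (\<omega> t) = v}"]
    by (auto simp: visited_def)
  show "end_component N (visited \<omega>)"
    unfolding end_component_def
  proof (intro conjI exI[of _ taken] ballI)
    show "visited \<omega> \<noteq> {}"
      using m(1)[of m] by blast
    show "visited \<omega> \<subseteq> states N"
      by (rule sub)
    show "taken u \<noteq> {}" if "u \<in> visited \<omega>" for u
      using that by (rule nonempty)
    show "enabled N u a" if "a \<in> taken u" for u a
      using that by (rule enabled)
    show "{v \<in> states N. 0 < tprob N u a v} \<subseteq> visited \<omega>" if "a \<in> taken u" for u a
      using closed[OF that] by auto
    show "(u, v) \<in> ?R\<^sup>*" if "u \<in> visited \<omega>" "v \<in> visited \<omega>" for u v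
      using that by (rule connected)
  qed
qed

lemma AE_end_component_visited:
  "AE \<omega> in mc_measure \<iota> K. mc_path \<iota> K \<omega> \<and> end_component N (visited \<omega>) \<and>
     (\<forall>\<^sub>F t in sequentially. obs (\<omega> t) \<in> visited \<omega>)"
proof -
  let ?Z = "\<lambda>u a v \<omega>. tprob N u a v > 0 \<longrightarrow> infinite {t. pre (\<omega> t) = u \<and> act (\<omega> t) = a} \<longrightarrow>
           infinite {t. (pre (\<omega> t) = u \<and> act (\<omega> t) = a) \<and> obs (\<omega> t) = v}"
  have "AE \<omega> in mc_measure \<iota> K. \<forall>u\<in>states N. \<forall>a\<in>UNIV. \<forall>v\<in>states N. ?Z u a v \<omega>"
  proof (intro AE_finite_allI finite_states finite_UNIV)
    fix u a v assume "v \<in> states N"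
    then show "AE \<omega> in mc_measure \<iota> K. ?Z u a v \<omega>"
      using AE_successor[of u a v] by (cases "tprob N u a v > 0") simp_all
  qed simp
  then show ?thesis
    using AE_mc_path[of \<iota> K]
  proof eventually_elim
    case (elim \<omega>)
    have "infinite {t. (pre (\<omega> t) = u \<and> act (\<omega> t) = a) \<and> obs (\<omega> t) = v}"
      if "v \<in> states N" "tprob N u a v > 0"
        and inf: "infinite {t. pre (\<omega> t) = u \<and> act (\<omega> t) = a}" for u a v
    proof -
      \<comment> \<open>At time 0 \<open>pre\<close> is not tied to any earlier observation, so a
        positive time is needed to place u among the states.\<close>
      obtain t' where "t' > 0" "pre (\<omega> t') = u"
        using inf unfolding infinite_nat_iff_unbounded by blast
      then obtain t where t: "pre (\<omega> (Suc t)) = u"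
        by (cases t') auto
      have reach: "mc_reach \<iota> K (\<omega> t)" and "\<omega> (Suc t) \<in> set_pmf (K (\<omega> t))"
        using elim(2) by (auto simp: mc_reach_def mc_path_def)
      then have "u \<in> states N"
        using pre_obs[OF reach] obs_states[OF reach] t by simp
      with elim(1) have "?Z u a v \<omega>"
        using that(1) UNIV_I[of a] by blast
      then show ?thesis
        using that(2) inf by simp
    qed
    then show ?case
      by (intro conjI elim(2) end_component_visited[OF elim(2)])
  qed
qed

text \<open>A randomised choice only averages the constraints of the individual actions, with the
  action probabilities as weights.\<close>

lemma nn_integral_superharmonic_le:
  assumes x0: "\<And>s. s \<in> states N \<Longrightarrow> x s \<ge> 0"
    and sup: "\<And>s a. s \<in> states N \<Longrightarrow> (\<Sum>t\<in>states N. tprob N s a t * x t) \<le> x s"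
    and h: "mc_reach \<iota> K h"
  shows "(\<integral>\<^sup>+y. ennreal (x (obs y)) \<partial>K h) \<le> ennreal (x (obs h))"
proof -
  let ?m = "\<lambda>a. measure (K h) {y. act y = a}"
  have "(\<integral>\<^sup>+y. ennreal (x (obs y)) \<partial>K h) =
      (\<integral>\<^sup>+y. (\<Sum>(a, v)\<in>UNIV \<times> states N. ennreal (x v) * indicator {y. act y = a \<and> obs y = v} y) \<partial>K h)"
  proof (intro nn_integral_cong_AE, subst AE_measure_pmf_iff, intro ballI)
    fix y assume "y \<in> set_pmf (K h)"
    then have "obs y \<in> states N"
      by (intro obs_states mc_reach_closed[OF h])
    then have "(\<Sum>(a, v)\<in>UNIV \<times> states N. ennreal (x v) * indicator {y. act y = a \<and> obs y = v} y) =
        (\<Sum>(a, v)\<in>{(act y, obs y)}. ennreal (x v) * indicator {y. act y = a \<and> obs y = v} y)"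
      by (intro sum.mono_neutral_right) (auto simp: finite_states indicator_def)
    then show "ennreal (x (obs y)) =
        (\<Sum>(a, v)\<in>UNIV \<times> states N. ennreal (x v) * indicator {y. act y = a \<and> obs y = v} y)"
      by simp
  qed
  also have "\<dots> = (\<Sum>(a, v)\<in>UNIV \<times> states N. ennreal (x v) * emeasure (K h) {y. act y = a \<and> obs y = v})"
    by (subst nn_integral_sum) (auto simp: case_prod_beta nn_integral_cmult)
  also have "\<dots> = (\<Sum>(a, v)\<in>UNIV \<times> states N. ennreal (?m a * (tprob N (obs h) a v * x v)))"
    by (intro sum.cong)
       (auto simp: measure_pmf.emeasure_eq_measure transition[OF h] x0 ennreal_mult'[symmetric] mult_ac)
  also have "\<dots> = ennreal (\<Sum>(a, v)\<in>UNIV \<times> states N. ?m a * (tprob N (obs h) a v * x v))"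
    by (subst sum_ennreal[symmetric])
       (auto simp: case_prod_beta intro!: mult_nonneg_nonneg x0 tprob_nonneg obs_states h)
  also have "(\<Sum>(a, v)\<in>UNIV \<times> states N. ?m a * (tprob N (obs h) a v * x v)) =
      (\<Sum>a\<in>UNIV. ?m a * (\<Sum>v\<in>states N. tprob N (obs h) a v * x v))"
    by (simp add: sum.cartesian_product[symmetric] sum_distrib_left)
  also have "\<dots> \<le> (\<Sum>a\<in>UNIV. ?m a * x (obs h))"
    by (intro sum_mono mult_left_mono sup obs_states h) auto
  also have "\<dots> = x (obs h) * (\<Sum>a\<in>UNIV. pmf (map_pmf act (K h)) a)"
    by (simp add: pmf_map vimage_def sum_distrib_left mult.commute)
  also have "(\<Sum>a\<in>UNIV. pmf (map_pmf act (K h)) a) = 1"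
    by (rule sum_pmf_eq_1) auto
  finally show ?thesis
    by (simp add: ennreal_leI)
qed

text \<open>Along almost every path the liminf is the least value of x on the visited set, which is
  why \<open>Y\<close> is compared with x at each visited state.\<close>

lemma nn_integral_le_superharmonic:
  assumes x0: "\<And>s. s \<in> states N \<Longrightarrow> x s \<ge> 0"
    and sup: "\<And>s a. s \<in> states N \<Longrightarrow> (\<Sum>t\<in>states N. tprob N s a t * x t) \<le> x s"
    and Y: "\<And>\<omega> s. mc_path \<iota> K \<omega> \<Longrightarrow> end_component N (visited \<omega>) \<Longrightarrow> s \<in> visited \<omega> \<Longrightarrow>
      Y \<omega> \<le> ennreal (x s)"
  shows "(\<integral>\<^sup>+\<omega>. Y \<omega> \<partial>mc_measure \<iota> K) \<le> (\<integral>\<^sup>+y. ennreal (x (obs y)) \<partial>\<iota>)"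
proof -
  define F where "F xs = ennreal (x (obs (last xs)))" for xs
  have F: "F (map \<omega> [0..<Suc n]) = ennreal (x (obs (\<omega> n)))" for \<omega> n
    by (simp add: F_def)
  have "(\<integral>\<^sup>+\<omega>. Y \<omega> \<partial>mc_measure \<iota> K) \<le> (\<integral>\<^sup>+\<omega>. liminf (\<lambda>n. F (map \<omega> [0..<Suc n])) \<partial>mc_measure \<iota> K)"
    unfolding F
  proof (rule nn_integral_mono_AE)
    show "AE \<omega> in mc_measure \<iota> K. Y \<omega> \<le> liminf (\<lambda>n. ennreal (x (obs (\<omega> n))))"
      using AE_end_component_visited
    proof eventually_elim
      case (elim \<omega>)
      then have "\<forall>\<^sub>F t in sequentially. Y \<omega> \<le> ennreal (x (obs (\<omega> t)))"
        by (auto elim!: eventually_mono intro: Y)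
      then show ?case
        by (rule Liminf_bounded)
    qed
  qed
  also have "\<dots> \<le> (\<integral>\<^sup>+y. F [y] \<partial>\<iota>)"
  proof (rule supermartingale_liminf_le)
    show "(\<lambda>\<omega>. F (map \<omega> [0..<Suc n])) \<in> borel_measurable (mc_measure \<iota> K)" for n
      unfolding F by (rule measurable_compose[OF measurable_mc_coordinate[where f="\<lambda>y. y"]]) simp
    show "(\<integral>\<^sup>+y. F (xs @ [y]) \<partial>K (last xs)) \<le> F xs" if "mc_reach \<iota> K (last xs)" for xs
      using nn_integral_superharmonic_le[OF x0 sup that] by (simp add: F_def)
  qed
  finally show ?thesis
    by (simp add: F_def)
qed

end

section \<open>Histories of the self-composition\<close>

lemma pmf_embed_finite_support:
  assumes "finite S" "\<And>s. s \<in> S \<Longrightarrow> 0 \<le> f s" "\<And>s. s \<notin> S \<Longrightarrow> f s = 0" "sum f S = 1"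
  shows "pmf (embed_pmf f) s = f s"
proof (rule pmf_embed_pmf)
  show "0 \<le> f s" for s
    using assms by (cases "s \<in> S") auto
  have "(\<integral>\<^sup>+s. ennreal (f s) \<partial>count_space UNIV) = (\<Sum>s\<in>S. ennreal (f s))"
    using assms by (intro nn_integral_count_space') auto
  also have "\<dots> = 1"
    using assms by (subst sum_ennreal) auto
  finally show "(\<integral>\<^sup>+s. ennreal (f s) \<partial>count_space UNIV) = 1" .
qed

lemma pmf_embed_iprob: "mdp M \<Longrightarrow> pmf (embed_pmf (iprob M)) s = iprob M s"
  by (rule pmf_embed_finite_support[of "states M"]) (auto simp: mdp_def)

lemma pmf_embed_tprob:
  "mdp M \<Longrightarrow> s \<in> states M \<Longrightarrow> enabled M s a \<Longrightarrow> pmf (embed_pmf (tprob M s a)) s' = tprob M s a s'"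
  by (rule pmf_embed_finite_support[of "states M"]) (auto simp: mdp_def enabled_def)

lemma states_self_comp: "states (self_comp M) = PiE UNIV (\<lambda>_. states M)"
  by (auto simp: self_comp_def)

lemma sum_tprob_self_comp:
  assumes "finite (states M)"
  shows "(\<Sum>f'\<in>states (self_comp M). tprob (self_comp M) f a f') =
    (\<Prod>i\<in>UNIV. \<Sum>s'\<in>states M. tprob M (f i) (a i) s')"
  unfolding states_self_comp using prod_sum_PiE[of UNIV "\<lambda>_. states M" "\<lambda>i. tprob M (f i) (a i)"] assms
  by (simp add: self_comp_def)

lemma iprob_self_comp_const: "iprob (self_comp M) (\<lambda>_::'n::finite. s) = iprob M s"
proof -
  have "(\<lambda>_::'n. s) = (\<lambda>_. t) \<longleftrightarrow> s = t" for t
    by metis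
  then show ?thesis
    by (simp add: self_comp_def)
qed

lemma iprob_self_comp_nonconst: "(f :: 'n::finite \<Rightarrow> 's) \<notin> range (\<lambda>s _. s) \<Longrightarrow> iprob (self_comp M) f = 0"
  by (auto simp: self_comp_def)

lemma tprob_nonzero_states: "mdp M \<Longrightarrow> tprob M s a s' \<noteq> 0 \<Longrightarrow> s \<in> states M \<and> s' \<in> states M"
  unfolding mdp_def by blast

lemma iprob_nonzero_states: "mdp M \<Longrightarrow> iprob M s \<noteq> 0 \<Longrightarrow> s \<in> states M"
  unfolding mdp_def by blast

lemma mdp_self_comp:
  fixes M :: "('s, 'a, 'l) mdp"
  assumes M: "mdp M"
  shows "mdp (self_comp M :: ('n::finite \<Rightarrow> 's, 'n \<Rightarrow> 'a, 'n \<Rightarrow> 'l) mdp)"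
proof -
  let ?C = "self_comp M :: ('n \<Rightarrow> 's, 'n \<Rightarrow> 'a, 'n \<Rightarrow> 'l) mdp"
  have fin: "finite (states M)"
    using M by (simp add: mdp_def)
  have st: "f \<in> states ?C \<longleftrightarrow> (\<forall>i. f i \<in> states M)" for f
    by (simp add: self_comp_def)
  note ip = iprob_self_comp_const[of M, where 'n='n]
    and ip0 = iprob_self_comp_nonconst[of _ M, where 'n='n]
  \<comment> \<open>All initial mass sits on the diagonal, a copy of
    \<open>states M\<close>.\<close>
  have "(\<Sum>f\<in>states ?C. iprob ?C f) = (\<Sum>f\<in>(\<lambda>s _. s) ` states M. iprob ?C f)"
  proof (rule sum.mono_neutral_right)
    show "finite (states ?C)"
      unfolding states_self_comp by (intro finite_PiE) (auto simp: fin)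
    show "(\<lambda>s _. s) ` states M \<subseteq> states ?C"
      by (auto simp: st)
    show "\<forall>f\<in>states ?C - (\<lambda>s _. s) ` states M. iprob ?C f = 0"
      using ip0 by (force simp: st)
  qed
  also have "\<dots> = (\<Sum>s\<in>states M. iprob M s)"
    by (subst sum.reindex) (auto simp: inj_on_def fun_eq_iff ip)
  finally have sum_ip: "(\<Sum>f\<in>states ?C. iprob ?C f) = 1"
    using M by (simp add: mdp_def)
  have tprob01: "0 \<le> tprob M s a t \<and> tprob M s a t \<le> 1" for s a t
    using M unfolding mdp_def by (cases "s \<in> states M \<and> t \<in> states M") auto
  have sum01: "(\<Sum>f'\<in>states ?C. tprob ?C f a f') \<in> {0, 1}" if "f \<in> states ?C" for f a
  proof -
    have "(\<Sum>s'\<in>states M. tprob M (f i) (a i) s') \<in> {0, 1}" for i :: 'n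
      using M that unfolding mdp_def st by blast
    then show ?thesis
      unfolding sum_tprob_self_comp[OF fin]
      by (cases "\<exists>i. (\<Sum>s'\<in>states M. tprob M (f i) (a i) s') = 0") (auto intro!: prod.neutral)
  qed
  have tprob_out: "tprob ?C f a f' = 0" if out: "f \<notin> states ?C \<or> f' \<notin> states ?C" for f a f'
  proof -
    obtain i where "f i \<notin> states M \<or> f' i \<notin> states M"
      using out unfolding st by blast
    then have "tprob M (f i) (a i) (f' i) = 0"
      using M by (auto simp: mdp_def)
    then show ?thesis
      by (auto simp: self_comp_def)
  qed
  show ?thesis
    unfolding mdp_def
  proof (intro conjI allI ballI impI)
    show "finite (states ?C)"
      unfolding states_self_comp by (intro finite_PiE) (auto simp: fin)
    show "0 \<le> tprob ?C f a f'" "tprob ?C f a f' \<le> 1" for f a f'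
      using tprob01 by (auto simp: self_comp_def intro!: prod_nonneg prod_le_1)
    show "0 \<le> iprob ?C f" if "f \<in> states ?C" for f
      using that ip0[of f] M by (cases "f \<in> range (\<lambda>s _. s)") (auto simp: ip st mdp_def)
    show "iprob ?C f = 0" if "f \<notin> states ?C" for f
      using that ip0[of f] M by (cases "f \<in> range (\<lambda>s _. s)") (auto simp: ip st mdp_def)
  qed (use sum_ip sum01 tprob_out in auto)
qed

lemma enabled_self_comp:
  assumes "mdp M" "\<And>i. enabled M (f i) (a i)"
  shows "enabled (self_comp M) f a"
  using assms sum_tprob_self_comp[of M f a] by (simp add: enabled_def mdp_def)

text \<open>These are the histories on which \<open>Sched\<close> constrains a scheduler; at them
  \<open>embed_pmf\<close> is applied to a genuine distribution for every chosen action.\<close>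

definition hist_ok :: "('s, 'a, 'l) mdp \<Rightarrow> ('s, 'a) history \<Rightarrow> bool" where
  "hist_ok M x \<longleftrightarrow> fst ` set (fst x) \<subseteq> states M \<and> snd x \<in> states M"

lemma Sched_enabled: "\<SS> \<in> Sched M \<Longrightarrow> hist_ok M (h, s) \<Longrightarrow> a \<in> set_pmf (\<SS> (h, s)) \<Longrightarrow> enabled M s a"
  unfolding Sched_def hist_ok_def by auto

lemma set_embed_iprob: "mdp M \<Longrightarrow> set_pmf (embed_pmf (iprob M)) = {s. iprob M s \<noteq> 0}"
  by (simp add: set_pmf_eq pmf_embed_iprob)

lemma set_hist_init:
  "mdp M \<Longrightarrow> x \<in> set_pmf (hist_init M) \<longleftrightarrow> fst x = [] \<and> iprob M (snd x) \<noteq> 0"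
  by (cases x) (auto simp: hist_init_def set_embed_iprob)

lemma set_hist_step:
  assumes "mdp M" "\<SS> \<in> Sched M" "hist_ok M (h, s)"
  shows "y \<in> set_pmf (hist_step M \<SS> (h, s)) \<longleftrightarrow>
    (\<exists>a\<in>set_pmf (\<SS> (h, s)). fst y = h @ [(s, a)] \<and> tprob M s a (snd y) \<noteq> 0)"
proof -
  have "s' \<in> set_pmf (embed_pmf (tprob M s a)) \<longleftrightarrow> tprob M s a s' \<noteq> 0"
    if "a \<in> set_pmf (\<SS> (h, s))" for a s'
    using assms that Sched_enabled[OF assms(2,3) that]
    by (simp add: set_pmf_iff pmf_embed_tprob hist_ok_def)
  then show ?thesis
    by (cases y) (auto simp: hist_step_def)
qed

lemma hist_ok_step:
  assumes "mdp M" "\<SS> \<in> Sched M" "hist_ok M x" "y \<in> set_pmf (hist_step M \<SS> x)"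
  shows "hist_ok M y"
  using assms set_hist_step[of M \<SS> "fst x" "snd x" y]
  by (auto 4 4 simp: hist_ok_def dest: tprob_nonzero_states)

lemma hist_ok_path:
  assumes "mdp M" "\<SS> \<in> Sched M" "mc_path (hist_init M) (hist_step M \<SS>) \<omega>"
  shows "hist_ok M (\<omega> t)"
proof (induction t)
  case 0
  then show ?case
    using assms set_hist_init[of M "\<omega> 0"]
    by (auto simp: mc_path_def hist_ok_def dest: iprob_nonzero_states)
next
  case (Suc t)
  then show ?case
    using assms by (auto simp: mc_path_def intro: hist_ok_step)
qed

lemma mc_path_hist_step:
  assumes "mdp M" "\<SS> \<in> Sched M" "mc_path (hist_init M) (hist_step M \<SS>) \<omega>"
  shows "\<exists>a\<in>set_pmf (\<SS> (\<omega> t)). fst (\<omega> (Suc t)) = fst (\<omega> t) @ [(snd (\<omega> t), a)] \<and>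
    tprob M (snd (\<omega> t)) a (snd (\<omega> (Suc t))) \<noteq> 0"
  using assms hist_ok_path[OF assms, of t]
    set_hist_step[of M \<SS> "fst (\<omega> t)" "snd (\<omega> t)" "\<omega> (Suc t)"]
  by (auto simp: mc_path_def)

text \<open>The new history records the action just drawn, so fixing its last action removes all
  other branches of the bind.\<close>

lemma measure_hist_step:
  "measure (hist_step M \<SS> (h, s)) {y. snd (last (fst y)) = a \<and> R y} =
     pmf (\<SS> (h, s)) a * measure (embed_pmf (tprob M s a)) {s'. R (h @ [(s, a)], s')}"
proof -
  let ?E = "\<lambda>a. embed_pmf (tprob M s a)"
  have "emeasure (hist_step M \<SS> (h, s)) {y. snd (last (fst y)) = a \<and> R y} =
      (\<integral>\<^sup>+b. emeasure (?E b) {s'. b = a \<and> R (h @ [(s, b)], s')} \<partial>\<SS> (h, s))"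
    by (simp add: hist_step_def emeasure_bind_pmf vimage_def)
  also have "\<dots> = (\<integral>\<^sup>+b. emeasure (?E a) {s'. R (h @ [(s, a)], s')} * indicator {a} b \<partial>\<SS> (h, s))"
    by (intro nn_integral_cong) (auto simp: indicator_def)
  also have "\<dots> = emeasure (?E a) {s'. R (h @ [(s, a)], s')} * emeasure (\<SS> (h, s)) {a}"
    by (rule nn_integral_cmult_indicator) simp
  finally show ?thesis
    by (simp add: measure_pmf.emeasure_eq_measure measure_pmf_single ennreal_mult''[symmetric]
        mult.commute)
qed

section \<open>Components of the parallel composition\<close>

lemma hist_ok_proj: "hist_ok (self_comp M) x \<Longrightarrow> hist_ok M (proj_history i x)"
  by (fastforce simp: hist_ok_def proj_history_def self_comp_def case_prod_beta)

lemma set_par_sched: "a \<in> set_pmf (par_sched \<SS> x) \<Longrightarrow> a i \<in> set_pmf (\<SS> i (proj_history i x))"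
  by (auto simp: par_sched_def set_Pi_pmf PiE_dflt_def)

lemma par_sched_Sched:
  assumes "mdp M" "\<And>i. \<SS> i \<in> Sched M"
  shows "par_sched \<SS> \<in> Sched (self_comp M)"
  unfolding Sched_def
proof (safe)
  fix h s a assume *: "fst ` set h \<subseteq> states (self_comp M)" "s \<in> states (self_comp M)"
    "a \<in> set_pmf (par_sched \<SS> (h, s))"
  show "enabled (self_comp M) s a"
  proof (rule enabled_self_comp[OF assms(1)])
    fix i
    have "hist_ok M (proj_history i (h, s))"
      using * by (intro hist_ok_proj) (simp add: hist_ok_def)
    then show "enabled M (s i) (a i)"
      using Sched_enabled[OF assms(2), of _ _ "a i"] set_par_sched[OF *(3), of i]
      by (simp add: proj_history_def)
  qed
qed

text \<open>A nonzero product has nonzero factors. This lets the premise on tuples of paths of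
  separate chains be applied to a single path of the self-composition.\<close>

lemma mc_path_proj:
  fixes \<SS> :: "'n::finite \<Rightarrow> ('s, 'a) scheduler"
  assumes M: "mdp M" and \<SS>: "\<And>i. \<SS> i \<in> Sched M"
    and path: "mc_path (hist_init (self_comp M)) (hist_step (self_comp M) (par_sched \<SS>)) \<omega>"
  shows "mc_path (hist_init M) (hist_step M (\<SS> i)) (\<lambda>t. proj_history i (\<omega> t))"
proof -
  note C = mdp_self_comp[OF M, where 'n='n] par_sched_Sched[of M \<SS>, OF M \<SS>] path
  have "proj_history i (\<omega> (Suc t)) \<in> set_pmf (hist_step M (\<SS> i) (proj_history i (\<omega> t)))" for t
  proof -
    obtain a where a: "a \<in> set_pmf (par_sched \<SS> (\<omega> t))"
        "fst (\<omega> (Suc t)) = fst (\<omega> t) @ [(snd (\<omega> t), a)]"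
        "tprob (self_comp M) (snd (\<omega> t)) a (snd (\<omega> (Suc t))) \<noteq> 0"
      using mc_path_hist_step[OF C] by blast
    have "tprob M (snd (\<omega> t) i) (a i) (snd (\<omega> (Suc t)) i) \<noteq> 0"
      using a(3) by (simp add: self_comp_def)
    moreover have "hist_ok M (proj_history i (\<omega> t))"
      by (rule hist_ok_proj) (rule hist_ok_path[OF C])
    moreover have "proj_history i (\<omega> t) =
        (fst (proj_history i (\<omega> t)), snd (\<omega> t) i)" for t
      by (simp add: proj_history_def case_prod_beta)
    ultimately show ?thesis
      using set_hist_step[OF M \<SS>, of "fst (proj_history i (\<omega> t))" "snd (\<omega> t) i"
          "proj_history i (\<omega> (Suc t))" i] set_par_sched[OF a(1), of i] a(2)
      by (auto simp: proj_history_def case_prod_beta)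
  qed
  moreover have "proj_history i (\<omega> 0) \<in> set_pmf (hist_init M)"
  proof -
    have "fst (\<omega> 0) = []" "iprob (self_comp M) (snd (\<omega> 0)) \<noteq> 0"
      using path C(1) by (auto simp: mc_path_def set_hist_init)
    moreover then obtain s where "snd (\<omega> 0) = (\<lambda>_. s)"
      using iprob_self_comp_nonconst[of "snd (\<omega> 0)" M] by auto
    ultimately show ?thesis
      by (simp add: set_hist_init[OF M] proj_history_def case_prod_beta iprob_self_comp_const)
  qed
  ultimately show ?thesis
    by (simp add: mc_path_def)
qed

section \<open>Observing the product\<close>

text \<open>The shift k is carried along so that the induction covers the suffixes met by the next
  and until operators.\<close>

lemma sets_ltl_sat:
  assumes "\<And>p t. {\<omega> \<in> space M. p \<in> w \<omega> t} \<in> sets M"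
  shows "{\<omega> \<in> space M. ltl_sat (\<lambda>t. w \<omega> (t + k)) \<phi>} \<in> sets M"
proof (induction \<phi> arbitrary: k)
  case (LNot \<phi>)
  then show ?case
    by (auto intro: sets.sets_Collect_neg)
next
  case (LNext \<phi>)
  show ?case
    using LNext[of "Suc k"] by simp
next
  case (LUntil \<phi> \<psi>)
  have "{\<omega> \<in> space M. ltl_sat (\<lambda>t. w \<omega> (t + (u + k))) \<psi>} \<in> sets M"
    "{\<omega> \<in> space M. ltl_sat (\<lambda>t. w \<omega> (t + (u + k))) \<phi>} \<in> sets M" for u
    using LUntil by blast+
  then show ?case
    by (auto simp: add.assoc intro!: sets.sets_Collect_countable_Ex sets.sets_Collect_countable_All
        sets.sets_Collect_conj sets.sets_Collect_imp)
qed (use assms in \<open>auto intro: sets.sets_Collect_conj\<close>)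

lemma infinite_Suc_iff: "infinite {t. P (Suc t)} \<longleftrightarrow> infinite {t::nat. P t}"
proof
  assume "infinite {t. P (Suc t)}"
  then show "infinite {t. P t}"
    using finite_vimageI[of "{t. P t}" Suc] by (auto simp: vimage_def)
next
  assume inf: "infinite {t. P t}"
  show "infinite {t. P (Suc t)}"
  proof
    assume "finite {t. P (Suc t)}"
    then have "finite (insert 0 (Suc ` {t. P (Suc t)}))"
      by simp
    moreover have "{t. P t} \<subseteq> insert 0 (Suc ` {t. P (Suc t)})"
    proof
      fix t assume "t \<in> {t. P t}"
      then show "t \<in> insert 0 (Suc ` {t. P (Suc t)})"
        by (cases t) auto
    qed
    ultimately show False
      using inf finite_subset by blast
  qed
qed

lemma finite_kept: "finite (states M) \<Longrightarrow> finite (kept M k)"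
  by (induction k) auto

text \<open>\<open>safe\<close> is the premise of the formula for one fixed tuple of schedulers,
  already translated into acceptance by the automaton.\<close>

locale safe_schedulers =
  fixes M :: "('s, 'a::finite, 'ap set) mdp"
    and D :: "('q, 'n::finite \<Rightarrow> 's) dsa"
    and A :: "'k::finite \<Rightarrow> ('r, ('ap \<times> 'n) set) dra"
    and \<SS> :: "'n \<Rightarrow> ('s, 'a) scheduler"
  assumes M: "mdp M"
    and D: "dsa {s. \<forall>i. s i \<in> states M} D"
    and A: "\<And>i. dra (A i)"
    and \<SS>: "\<And>i. \<SS> i \<in> Sched M"
    and safe: "\<And>w. (\<And>i. (\<lambda>t. w t i) \<in> paths M (\<SS> i)) \<Longrightarrow> dsa_accepts D w"
begin

abbreviation C where "C \<equiv> self_comp M :: ('n \<Rightarrow> 's, 'n \<Rightarrow> 'a, 'n \<Rightarrow> 'ap set) mdp"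
abbreviation T where "T \<equiv> par_sched \<SS>"
abbreviation \<iota> where "\<iota> \<equiv> hist_init C"
abbreviation K where "K \<equiv> hist_step C T"
abbreviation N where "N \<equiv> M_tilde (M_chi M D) A"

definition lab :: "('n \<Rightarrow> 's) \<Rightarrow> ('ap \<times> 'n) set" where
  "lab s = atoms (label C s)"

definition hist_word :: "('n \<Rightarrow> 's, 'n \<Rightarrow> 'a) history \<Rightarrow> ('n \<Rightarrow> 's) list" where
  "hist_word x = map fst (fst x) @ [snd x]"

text \<open>The state after reading the current letter as well, as in the initial distribution of
  the product. \<open>the\<close> is justified on reachable histories by
  \<open>dstate_step\<close>.\<close>

definition dstate :: "('n \<Rightarrow> 's, 'n \<Rightarrow> 'a) history \<Rightarrow> 'q" where
  "dstate x = foldl (\<lambda>q s. the (sdelta D q s)) (sinit D) (hist_word x)"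

definition rstate :: "('n \<Rightarrow> 's, 'n \<Rightarrow> 'a) history \<Rightarrow> 'k \<Rightarrow> 'r" where
  "rstate x i = foldl (rdelta (A i)) (rinit (A i)) (map lab (hist_word x))"

definition obs :: "('n \<Rightarrow> 's, 'n \<Rightarrow> 'a) history \<Rightarrow> (('n \<Rightarrow> 's) \<times> 'q) \<times> ('k \<Rightarrow> 'r)" where
  "obs x = ((snd x, dstate x), rstate x)"

text \<open>The last step is undone; this is meaningful only for histories with at least one
  step.\<close>

definition pre :: "('n \<Rightarrow> 's, 'n \<Rightarrow> 'a) history \<Rightarrow> (('n \<Rightarrow> 's) \<times> 'q) \<times> ('k \<Rightarrow> 'r)" where
  "pre x = obs (butlast (fst x), fst (last (fst x)))"

definition act :: "('n \<Rightarrow> 's, 'n \<Rightarrow> 'a) history \<Rightarrow> 'n \<Rightarrow> 'a" where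
  "act x = snd (last (fst x))"

definition raw :: "(('n \<Rightarrow> 's) \<times> 'q, 'n \<Rightarrow> 'a, ('ap \<times> 'n) set) mdp" where
  "raw = \<lparr> states = states C \<times> sstates D,
       tprob = (\<lambda>(s, q) a (s', q'). if sdelta D q s' = Some q' then tprob C s a s' else 0),
       iprob = (\<lambda>(s, q). if sdelta D (sinit D) s = Some q then iprob C s else 0),
       label = (\<lambda>(s, q). {(a, j). a \<in> label M (s j)}) \<rparr>"

lemma M_chi_eq: "M_chi M D = prune raw"
  by (simp add: M_chi_def raw_def)

lemma C: "mdp C"
  by (rule mdp_self_comp[OF M])

lemma T: "T \<in> Sched C"
  by (rule par_sched_Sched[OF M \<SS>])

lemma lab_eq: "lab s = {(a, j). a \<in> label M (s j)}"
  by (simp add: lab_def atoms_def self_comp_def)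

lemma reach_hist_ok: "mc_reach \<iota> K x \<Longrightarrow> hist_ok C x"
  unfolding mc_reach_def using hist_ok_path[OF C T] by blast

lemma reach_state: "mc_reach \<iota> K x \<Longrightarrow> snd x \<in> states C"
  using reach_hist_ok by (simp add: hist_ok_def)

lemma set_K:
  assumes "mc_reach \<iota> K (h, s)"
  shows "y \<in> set_pmf (K (h, s)) \<longleftrightarrow>
    (\<exists>a\<in>set_pmf (T (h, s)). fst y = h @ [(s, a)] \<and> tprob C s a (snd y) \<noteq> 0)"
  by (rule set_hist_step[OF C T reach_hist_ok[OF assms]])

lemma reach_stepE:
  assumes "mc_reach \<iota> K x" "y \<in> set_pmf (K x)"
  obtains a where "a \<in> set_pmf (T x)" "fst y = fst x @ [(snd x, a)]" "tprob C (snd x) a (snd y) \<noteq> 0"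
  using assms set_K[of "fst x" "snd x" y] by auto

lemma hist_word_snoc: "hist_word (h @ [(s, a)], s') = hist_word (h, s) @ [s']"
  by (simp add: hist_word_def)

lemma hist_word_path:
  assumes "mc_path \<iota> K \<omega>"
  shows "hist_word (\<omega> t) = map (\<lambda>u. snd (\<omega> u)) [0..<Suc t]"
proof (induction t)
  case 0
  have "\<omega> 0 \<in> set_pmf \<iota>"
    using assms unfolding mc_path_def by blast
  then show ?case
    unfolding set_hist_init[OF C] by (simp add: hist_word_def)
next
  case (Suc t)
  obtain a where "fst (\<omega> (Suc t)) = fst (\<omega> t) @ [(snd (\<omega> t), a)]"
    using mc_path_hist_step[OF C T assms, of t] by blast
  then have "hist_word (\<omega> (Suc t)) = hist_word (\<omega> t) @ [snd (\<omega> (Suc t))]"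
    by (simp add: hist_word_def)
  also have "\<dots> = map (\<lambda>u. snd (\<omega> u)) [0..<Suc (Suc t)]"
    unfolding Suc.IH by simp
  finally show ?case .
qed

lemma dstate_run:
  assumes path: "mc_path \<iota> K \<omega>"
  shows "sdelta D (sinit D) (snd (\<omega> 0)) = Some (dstate (\<omega> 0))"
    and "sdelta D (dstate (\<omega> t)) (snd (\<omega> (Suc t))) = Some (dstate (\<omega> (Suc t)))"
proof -
  have "dsa_accepts D (\<lambda>t. snd (\<omega> t))"
  proof (rule safe)
    fix i
    have "mc_path (hist_init M) (hist_step M (\<SS> i)) (\<lambda>t. proj_history i (\<omega> t))"
      by (rule mc_path_proj[OF M \<SS> path])
    moreover have "(\<lambda>t. snd (\<omega> t) i) = state_seq (\<lambda>t. proj_history i (\<omega> t))"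
      by (simp add: state_seq_def proj_history_def case_prod_beta fun_eq_iff)
    ultimately show "(\<lambda>t. snd (\<omega> t) i) \<in> paths M (\<SS> i)"
      by (auto simp: paths_def)
  qed
  then obtain r where r: "r 0 = sinit D" "\<And>t. sdelta D (r t) (snd (\<omega> t)) = Some (r (Suc t))"
    unfolding dsa_accepts_def by blast
  \<comment> \<open>Position t of the path corresponds to Suc t of the run, since the letters 0 to t
    have been read.\<close>
  have run: "dstate (\<omega> t) = r (Suc t)" for t
  proof (induction t)
    case 0
    then show ?case
      using r(2)[of 0] by (simp add: dstate_def hist_word_path[OF path] r(1))
  next
    case (Suc t)
    then show ?case
      using r(2)[of "Suc t"] by (simp add: dstate_def hist_word_path[OF path])
  qed
  show "sdelta D (sinit D) (snd (\<omega> 0)) = Some (dstate (\<omega> 0))"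
    using r(2)[of 0] by (simp add: run r(1))
  show "sdelta D (dstate (\<omega> t)) (snd (\<omega> (Suc t))) = Some (dstate (\<omega> (Suc t)))"
    using r(2)[of "Suc t"] by (simp add: run)
qed

lemma dstate_step:
  assumes "mc_reach \<iota> K x" "y \<in> set_pmf (K x)"
  shows "sdelta D (dstate x) (snd y) = Some (dstate y)"
  using mc_reach_step[OF assms] dstate_run(2) by blast

lemma dstate_init:
  assumes "x \<in> set_pmf \<iota>"
  shows "sdelta D (sinit D) (snd x) = Some (dstate x)"
proof -
  obtain \<omega> where "mc_path \<iota> K \<omega>" "\<omega> 0 = x"
    using mc_path_extend[of 0 "\<lambda>_. x" K \<iota>] assms by auto
  then show ?thesis
    using dstate_run(1) by blast
qed

lemma sdelta_states: "q \<in> sstates D \<Longrightarrow> s \<in> states C \<Longrightarrow> sdelta D q s = Some q' \<Longrightarrow> q' \<in> sstates D"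
  using D unfolding dsa_def self_comp_def by fastforce

lemma dstate_states:
  assumes "mc_reach \<iota> K x"
  shows "dstate x \<in> sstates D"
proof -
  obtain \<omega> t where path: "mc_path \<iota> K \<omega>" and "\<omega> t = x"
    using assms unfolding mc_reach_def by blast
  have st: "snd (\<omega> t) \<in> states C" for t
    using path by (intro reach_state) (auto simp: mc_reach_def)
  have "dstate (\<omega> t) \<in> sstates D" for t
  proof (induction t)
    case 0
    then show ?case
      using sdelta_states[OF _ st dstate_run(1)[OF path]] D by (simp add: dsa_def)
  next
    case (Suc t)
    then show ?case
      by (rule sdelta_states[OF _ st dstate_run(2)[OF path]])
  qed
  with \<open>\<omega> t = x\<close> show ?thesis by blast
qed

lemma rstate_states: "rstate x i \<in> rstates (A i)"
proof -
  have "foldl (rdelta (A i)) q ls \<in> rstates (A i)" if "q \<in> rstates (A i)" for q ls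
    using that A[of i] by (induction ls arbitrary: q) (auto simp: dra_def)
  then show ?thesis
    using A[of i] by (simp add: rstate_def dra_def)
qed

section \<open>Reachable histories survive the pruning\<close>

lemma finite_raw: "finite (states raw)"
  using C D by (simp add: raw_def mdp_def dsa_def)

lemma raw_nonneg: "0 \<le> tprob raw u a v" "0 \<le> iprob raw u"
proof -
  have "0 \<le> tprob C s a s'" for s s'
    using C tprob_nonzero_states[OF C, of s a s'] unfolding mdp_def
    by (cases "tprob C s a s' = 0") auto
  moreover have "0 \<le> iprob C s" for s
    using C iprob_nonzero_states[OF C, of s] unfolding mdp_def
    by (cases "iprob C s = 0") auto
  ultimately show "0 \<le> tprob raw u a v" "0 \<le> iprob raw u"
    by (auto simp: raw_def split: prod.splits)
qed

text \<open>The automaton component of a successor is a function of its state component, so the sum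
  collapses to one over states of the self-composition. V is kept general to serve both a pruning
  round and its limit.\<close>

lemma sum_tprob_raw:
  assumes x: "mc_reach \<iota> K x" and a: "a \<in> set_pmf (T x)" and "finite V"
    and V: "\<And>y. y \<in> set_pmf (K x) \<Longrightarrow> (snd y, dstate y) \<in> V"
  shows "(\<Sum>v\<in>V. tprob raw (snd x, dstate x) a v) = 1"
proof -
  let ?q = "dstate x" and ?s = "snd x"
  let ?P = "{s' \<in> states C. tprob C ?s a s' \<noteq> 0}"
  let ?g = "\<lambda>s'. (s', the (sdelta D ?q s'))"
  have succ: "sdelta D ?q s' = Some (the (sdelta D ?q s'))" "?g s' \<in> V"
    if "tprob C ?s a s' \<noteq> 0" for s'
  proof -
    have y: "(fst x @ [(?s, a)], s') \<in> set_pmf (K x)"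
      using set_K[of "fst x" ?s] x a that by simp
    show "sdelta D ?q s' = Some (the (sdelta D ?q s'))" "?g s' \<in> V"
      using dstate_step[OF x y] V[OF y] by simp_all
  qed
  have "(\<Sum>v\<in>V. tprob raw (?s, ?q) a v) = (\<Sum>v\<in>?g ` ?P. tprob raw (?s, ?q) a v)"
  proof (rule sum.mono_neutral_right[OF \<open>finite V\<close>])
    show "?g ` ?P \<subseteq> V"
      using succ(2) by blast
    show "\<forall>v\<in>V - ?g ` ?P. tprob raw (?s, ?q) a v = 0"
    proof (intro ballI, rule ccontr)
      fix v assume v: "v \<in> V - ?g ` ?P" and "tprob raw (?s, ?q) a v \<noteq> 0"
      then have *: "sdelta D ?q (fst v) = Some (snd v)" "tprob C ?s a (fst v) \<noteq> 0"
        by (auto simp: raw_def case_prod_beta split: if_splits)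
      then have "v = ?g (fst v)"
        by (simp add: prod_eq_iff)
      moreover have "fst v \<in> ?P"
        using * tprob_nonzero_states[OF C *(2)] by simp
      ultimately show False
        using v by blast
    qed
  qed
  also have "\<dots> = (\<Sum>s'\<in>?P. tprob raw (?s, ?q) a (?g s'))"
    by (subst sum.reindex) (auto simp: inj_on_def)
  also have "\<dots> = (\<Sum>s'\<in>?P. tprob C ?s a s')"
    using succ(1) by (intro sum.cong) (auto simp: raw_def)
  also have "\<dots> = (\<Sum>s'\<in>states C. tprob C ?s a s')"
    using C by (intro sum.mono_neutral_left) (auto simp: mdp_def)
  also have "\<dots> = 1"
    using Sched_enabled[OF T, of "fst x" ?s a] reach_hist_ok[OF x] a by (simp add: enabled_def)
  finally show ?thesis .
qed

text \<open>The schedulers' choices lead from reachable states to reachable states only, so no round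
  can be the first to remove one of them.\<close>

lemma kept_reach:
  assumes "mc_reach \<iota> K x"
  shows "(snd x, dstate x) \<in> kept raw k"
  using assms
proof (induction k arbitrary: x)
  case 0
  then show ?case
    by (simp add: raw_def reach_state dstate_states)
next
  case (Suc k)
  obtain a where "a \<in> set_pmf (T x)"
    using set_pmf_not_empty[of "T x"] by blast
  then have "(\<Sum>v\<in>kept raw k. tprob raw (snd x, dstate x) a v) = 1"
    by (rule sum_tprob_raw[OF Suc.prems _ finite_kept[OF finite_raw]])
      (rule Suc.IH[OF mc_reach_closed[OF Suc.prems]])
  with Suc.IH[OF Suc.prems] show ?case
    by auto
qed

lemma M_chi_reach: "mc_reach \<iota> K x \<Longrightarrow> (snd x, dstate x) \<in> states (M_chi M D)"
  using kept_reach by (simp add: M_chi_eq prune_def)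

lemma states_M_chi: "states (M_chi M D) \<subseteq> states raw"
  using INT_lower[of 0 UNIV "kept raw"] by (simp add: M_chi_eq prune_def)

lemma finite_N: "finite (states N)"
proof -
  have "finite {r. \<forall>i. r i \<in> rstates (A i)}"
    using finite_PiE[of UNIV "\<lambda>i. rstates (A i)"] A by (simp add: dra_def PiE_def Pi_def)
  then show ?thesis
    using finite_subset[OF states_M_chi finite_raw] by (simp add: M_tilde_def)
qed

lemma N_nonneg: "0 \<le> tprob N u a v" "0 \<le> iprob N u"
  by (simp_all add: M_tilde_def M_chi_eq prune_def Let_def case_prod_beta raw_nonneg)

lemma obs_states: "mc_reach \<iota> K x \<Longrightarrow> obs x \<in> states N"
  by (simp add: obs_def M_tilde_def M_chi_reach rstate_states)

lemma label_M_chi: "label (M_chi M D) (s, q) = lab s"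
  by (simp add: M_chi_eq prune_def raw_def lab_eq)

lemma obs_snoc:
  "obs (h @ [(s, a)], s') =
    ((s', the (sdelta D (dstate (h, s)) s')), \<lambda>i. rdelta (A i) (rstate (h, s) i) (lab s'))"
  by (simp add: obs_def dstate_def rstate_def[abs_def] hist_word_snoc)

text \<open>Pruning keeps an action of a kept state when its whole mass stays among the kept states,
  as it does for every action the schedulers choose.\<close>

lemma tprob_M_chi:
  assumes x: "mc_reach \<iota> K x" and a: "a \<in> set_pmf (T x)" and v: "v \<in> states (M_chi M D)"
  shows "tprob (M_chi M D) (snd x, dstate x) a v = tprob raw (snd x, dstate x) a v"
proof -
  have "(\<Sum>u\<in>states (M_chi M D). tprob raw (snd x, dstate x) a u) = 1"
  proof (rule sum_tprob_raw[OF x a])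
    show "finite (states (M_chi M D))"
      by (rule finite_subset[OF states_M_chi finite_raw])
    show "(snd y, dstate y) \<in> states (M_chi M D)" if "y \<in> set_pmf (K x)" for y
      by (rule M_chi_reach[OF mc_reach_closed[OF x that]])
  qed
  with v M_chi_reach[OF x] show ?thesis
    by (simp add: M_chi_eq prune_def Let_def)
qed

lemma transition:
  assumes x: "mc_reach \<iota> K x" and v: "v \<in> states N"
  shows "measure (K x) {y. act y = a \<and> obs y = v} =
    measure (K x) {y. act y = a} * tprob N (obs x) a v"
proof -
  obtain h s where hs: "x = (h, s)"
    by (cases x)
  obtain s1 q1 r1 where v_eq: "v = ((s1, q1), r1)"
    by (cases v; cases "fst v") auto
  have v1: "(s1, q1) \<in> states (M_chi M D)"
    using v by (simp add: v_eq M_tilde_def)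
  let ?E = "embed_pmf (tprob C s a)"
  define R where "R \<longleftrightarrow> (\<forall>i. r1 i = rdelta (A i) (rstate x i) (lab s1))"
  have "measure ?E {s'. obs (h @ [(s, a)], s') = v} = tprob N (obs x) a v"
    if a: "a \<in> set_pmf (T x)"
  proof -
    have tN: "tprob N (obs x) a v =
        (if R \<and> sdelta D (dstate x) s1 = Some q1 then tprob C s a s1 else 0)"
      using tprob_M_chi[OF x a v1]
      by (simp add: M_tilde_def obs_def v_eq label_M_chi hs R_def) (simp add: raw_def)
    have pE: "pmf ?E s1 = tprob C s a s1"
      using pmf_embed_tprob[OF C, of s a] reach_state[OF x] reach_hist_ok[OF x] a
        Sched_enabled[OF T, of h s a] by (simp add: hs)
    have "obs (h @ [(s, a)], s') = v \<longleftrightarrow> s' = s1 \<and> R \<and> the (sdelta D (dstate x) s1) = q1" for s'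
      unfolding obs_snoc v_eq hs R_def prod.inject fun_eq_iff[of _ r1] by fastforce
    then have set_eq: "{s'. obs (h @ [(s, a)], s') = v} =
        (if R \<and> the (sdelta D (dstate x) s1) = q1 then {s1} else {})"
      by (cases "R \<and> the (sdelta D (dstate x) s1) = q1") auto
    show ?thesis
    \<comment> \<open>The automaton may have no transition on s1, and then \<open>the\<close> says
      nothing; by safety this happens only in steps of probability zero.\<close>
    proof (cases "tprob C s a s1 = 0")
      case True
      then show ?thesis
        unfolding set_eq tN by (simp add: measure_pmf_single pE)
    next
      case False
      then have "(h @ [(s, a)], s1) \<in> set_pmf (K x)"
        using set_K[of h s] x a by (simp add: hs)
      then obtain d where d: "sdelta D (dstate x) s1 = Some d"
        using dstate_step[OF x] by fastforce
      show ?thesis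
        unfolding set_eq tN d by (simp add: measure_pmf_single pE)
    qed
  qed
  \<comment> \<open>For an action that is never chosen both sides vanish, whatever
    \<open>embed_pmf\<close> yields.\<close>
  then have "pmf (T x) a * measure ?E {s'. obs (h @ [(s, a)], s') = v} =
      pmf (T x) a * tprob N (obs x) a v"
    by (cases "pmf (T x) a = 0") (simp_all add: set_pmf_iff)
  moreover have "measure (K x) {y. act y = a \<and> obs y = v} =
      pmf (T x) a * measure ?E {s'. obs (h @ [(s, a)], s') = v}"
    unfolding hs act_def by (rule measure_hist_step)
  moreover have "measure (K x) {y. act y = a} = pmf (T x) a"
    using measure_hist_step[of C T h s a "\<lambda>_. True"] by (simp add: hs act_def)
  ultimately show ?thesis
    by simp
qed

lemma pre_step:
  assumes "mc_reach \<iota> K x" "y \<in> set_pmf (K x)"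
  shows "pre y = obs x"
proof -
  obtain a where "fst y = fst x @ [(snd x, a)]"
    by (rule reach_stepE[OF assms])
  then show ?thesis
    by (simp add: pre_def)
qed

sublocale mdp_observation N \<iota> K obs pre act
  by unfold_locales (rule finite_N N_nonneg(1) obs_states pre_step transition; assumption)+

text \<open>The run is one step ahead because its initial state precedes the first letter.\<close>

lemma dra_run_path:
  assumes "mc_path \<iota> K \<omega>"
  shows "dra_run (A i) (\<lambda>t. lab (snd (\<omega> t))) (Suc t) = rstate (\<omega> t) i"
proof -
  have "dra_run (A i) w n = foldl (rdelta (A i)) (rinit (A i)) (map w [0..<n])" for w n
    by (induction n) auto
  then show ?thesis
    by (simp add: rstate_def hist_word_path[OF assms] comp_def del: upt_Suc dra_run.simps)
qed

text \<open>With finitely many product states, a Rabin state recurs exactly when some recurring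
  product state has it as its component.\<close>

lemma accepting_visited:
  assumes path: "mc_path \<iota> K \<omega>" and acc: "dra_accepts (A i) (\<lambda>t. lab (snd (\<omega> t)))"
  shows "\<exists>(B, G)\<in>set (rpairs (A i)).
    visited \<omega> \<inter> {s \<in> states N. snd s i \<in> B} = {} \<and> visited \<omega> \<inter> {s \<in> states N. snd s i \<in> G} \<noteq> {}"
proof -
  let ?run = "dra_run (A i) (\<lambda>t. lab (snd (\<omega> t)))"
  have run: "infinite {t. ?run t \<in> X} \<longleftrightarrow> infinite {t. snd (obs (\<omega> t)) i \<in> X}" for X
    using infinite_Suc_iff[of "\<lambda>t. ?run t \<in> X"] dra_run_path[OF path, of i] by (simp add: obs_def)
  obtain B G where BG: "(B, G) \<in> set (rpairs (A i))" "finite {t. ?run t \<in> B}" "infinite {t. ?run t \<in> G}"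
    using acc unfolding dra_accepts_def by blast
  have "snd w i \<notin> B" if "w \<in> visited \<omega>" for w
  proof
    assume "snd w i \<in> B"
    then have "{t. obs (\<omega> t) = w} \<subseteq> {t. snd (obs (\<omega> t)) i \<in> B}"
      by blast
    moreover have "infinite {t. obs (\<omega> t) = w}"
      using that unfolding visited_def by blast
    ultimately show False
      using BG(2) run[of B] finite_subset by blast
  qed
  moreover have "\<exists>w\<in>visited \<omega> \<inter> states N. snd w i \<in> G"
  proof (rule ccontr)
    assume "\<not> ?thesis"
    then have "finite {t. obs (\<omega> t) = w}" if "w \<in> states N" "snd w i \<in> G" for w
      using that unfolding visited_def by blast
    then have "finite (\<Union>w\<in>{w \<in> states N. snd w i \<in> G}. {t. obs (\<omega> t) = w})"
      using finite_N by (intro finite_UN_I) simp_all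
    moreover have "obs (\<omega> t) \<in> states N" for t
      using path unfolding mc_reach_def by (intro obs_states) (unfold mc_reach_def, blast)
    then have "{t. snd (obs (\<omega> t)) i \<in> G} \<subseteq>
        (\<Union>w\<in>{w \<in> states N. snd w i \<in> G}. {t. obs (\<omega> t) = w})"
      by blast
    ultimately show False
      using BG(3) run[of G] finite_subset by blast
  qed
  ultimately show ?thesis
    using BG(1) by blast
qed

lemma iprob_N_init:
  assumes "s \<in> set_pmf (embed_pmf (iprob C))"
  shows "obs ([], s) \<in> states N" "iprob N (obs ([], s)) = iprob C s"
proof -
  have init: "([], s) \<in> set_pmf \<iota>"
    using assms by (simp add: hist_init_def)
  then have reach: "mc_reach \<iota> K ([], s)"
    by (rule mc_reach_init)
  then show "obs ([], s) \<in> states N"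
    by (rule obs_states)
  have "iprob (M_chi M D) (s, dstate ([], s)) = iprob raw (s, dstate ([], s))"
    using M_chi_reach[OF reach] by (simp add: M_chi_eq prune_def Let_def)
  also have "\<dots> = iprob C s"
    using dstate_init[OF init] by (simp add: raw_def)
  finally show "iprob N (obs ([], s)) = iprob C s"
    by (simp add: M_tilde_def obs_def label_M_chi rstate_def hist_word_def)
qed

text \<open>Initial histories are observed injectively and with unchanged mass; the remaining terms
  of the sum are nonnegative.\<close>

lemma nn_integral_init_le:
  assumes "\<And>w. w \<in> states N \<Longrightarrow> 0 \<le> x w"
  shows "(\<integral>\<^sup>+y. ennreal (x (obs y)) \<partial>\<iota>) \<le> ennreal (\<Sum>w\<in>states N. iprob N w * x w)"
proof -
  let ?E = "embed_pmf (iprob C)" and ?g = "\<lambda>s. obs ([], s)"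
  have fin: "finite (set_pmf ?E)"
    using C finite_subset[of "set_pmf ?E" "states C"] iprob_nonzero_states[OF C]
    by (auto simp: set_embed_iprob mdp_def)
  have inj: "inj_on ?g (set_pmf ?E)"
    by (auto simp: inj_on_def obs_def)
  have "(\<integral>\<^sup>+y. ennreal (x (obs y)) \<partial>\<iota>) = (\<integral>\<^sup>+s. ennreal (x (?g s)) \<partial>?E)"
    by (simp add: hist_init_def)
  also have "\<dots> = (\<Sum>s\<in>set_pmf ?E. ennreal (x (?g s)) * ennreal (pmf ?E s))"
    by (rule nn_integral_measure_pmf_finite[OF fin]) simp
  also have "\<dots> = (\<Sum>s\<in>set_pmf ?E. ennreal (iprob N (?g s) * x (?g s)))"
    by (intro sum.cong refl) (simp add: pmf_embed_iprob[OF C] iprob_N_init N_nonneg assms ennreal_mult''[symmetric] mult.commute)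
  also have "\<dots> = ennreal (\<Sum>s\<in>set_pmf ?E. iprob N (?g s) * x (?g s))"
    by (rule sum_ennreal) (intro mult_nonneg_nonneg N_nonneg assms iprob_N_init)
  also have "(\<Sum>s\<in>set_pmf ?E. iprob N (?g s) * x (?g s)) = (\<Sum>w\<in>?g ` set_pmf ?E. iprob N w * x w)"
    by (simp add: sum.reindex[OF inj])
  also have "\<dots> \<le> (\<Sum>w\<in>states N. iprob N w * x w)"
    using iprob_N_init(1) finite_N by (intro sum_mono2) (auto intro!: mult_nonneg_nonneg N_nonneg assms)
  finally show ?thesis
    by (simp add: ennreal_leI)
qed

theorem weighted_probability_le:
  assumes c: "\<And>i. c i > 0"
    and \<phi>: "\<And>i w. dra_accepts (A i) w \<longleftrightarrow> ltl_sat w (\<phi> i)"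
    and x: "lp_feasible N A c x"
  shows "(\<Sum>i\<in>UNIV. c i * ltl_prob C T (\<phi> i)) \<le> (\<Sum>w\<in>states N. iprob N w * x w)"
proof -
  interpret P: prob_space "mc_measure \<iota> K"
    by (rule prob_space_mc_measure)
  define S where "S i = {\<omega> :: nat \<Rightarrow> ('n \<Rightarrow> 's, 'n \<Rightarrow> 'a) history. ltl_sat (\<lambda>t. lab (snd (\<omega> t))) (\<phi> i)}" for i
  have "{\<omega>. p \<in> lab (snd (\<omega> t))} \<in> sets (mc_measure \<iota> K)" for p t
    using measurable_sets[OF measurable_mc_coordinate[where f="\<lambda>y. y"], of "{y. p \<in> lab (snd y)}"]
    by (simp add: vimage_def)
  then have S: "S i \<in> sets (mc_measure \<iota> K)" for i
    using sets_ltl_sat[of "mc_measure \<iota> K" "\<lambda>\<omega> t. lab (snd (\<omega> t))" 0 "\<phi> i"] by (simp add: S_def)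
  have prob: "ltl_prob C T (\<phi> i) = P.prob (S i)" for i
    by (simp add: ltl_prob_def path_measure_def S_def lab_def state_seq_def)
  have x0: "\<And>s. s \<in> states N \<Longrightarrow> 0 \<le> x s"
    and xU: "\<And>I s. I \<noteq> {} \<Longrightarrow> s \<in> success_set N A I \<Longrightarrow> (\<Sum>i\<in>I. c i) \<le> x s"
    and xs: "\<And>s a. s \<in> states N \<Longrightarrow> (\<Sum>t\<in>states N. tprob N s a t * x t) \<le> x s"
    using x unfolding lp_feasible_def by blast+
  define Y where "Y \<omega> = (\<Sum>i\<in>UNIV. ennreal (c i) * indicator (S i) \<omega>)" for \<omega>
  have Y_le: "Y \<omega> \<le> ennreal (x s)"
    if path: "mc_path \<iota> K \<omega>" and E: "end_component N (visited \<omega>)" and s: "s \<in> visited \<omega>" for \<omega> s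
  proof -
    \<comment> \<open>I depends on the path: it is the index set for which the visited end component
      is a witness in the success set.\<close>
    define I where "I = {i. \<omega> \<in> S i}"
    have "Y \<omega> = (\<Sum>i\<in>I. ennreal (c i))"
      unfolding Y_def by (intro sum.mono_neutral_cong_right) (auto simp: I_def)
    also have "\<dots> = ennreal (\<Sum>i\<in>I. c i)"
      using c by (intro sum_ennreal) (simp add: less_imp_le)
    also have "(\<Sum>i\<in>I. c i) \<le> x s"
    \<comment> \<open>Success sets give constraints for nonempty I only; with no formula satisfied,
      nonnegativity of x is what is required.\<close>
    proof (cases "I = {}")
      case True
      have "s \<in> states N"
        using E s unfolding end_component_def by blast
      with True show ?thesis
        using x0 by simp
    next
      case False
      have "\<exists>(B, G)\<in>set (rpairs (A i)). visited \<omega> \<inter> {s \<in> states N. snd s i \<in> B} = {} \<and>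
          visited \<omega> \<inter> {s \<in> states N. snd s i \<in> G} \<noteq> {}" if "i \<in> I" for i
        using that by (intro accepting_visited[OF path]) (simp add: \<phi> I_def S_def)
      then have "s \<in> success_set N A I"
        using E s unfolding success_set_def by blast
      then show ?thesis
        by (rule xU[OF False])
    qed
    finally show ?thesis
      by (simp add: ennreal_leI)
  qed
  have "ennreal (\<Sum>i\<in>UNIV. c i * ltl_prob C T (\<phi> i)) = (\<Sum>i\<in>UNIV. ennreal (c i) * emeasure (mc_measure \<iota> K) (S i))"
    using c by (subst sum_ennreal[symmetric])
      (auto simp: prob P.emeasure_eq_measure ennreal_mult'' less_imp_le)
  also have "\<dots> = (\<integral>\<^sup>+\<omega>. Y \<omega> \<partial>mc_measure \<iota> K)"
    unfolding Y_def by (subst nn_integral_sum)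
      (auto simp: S nn_integral_cmult_indicator intro!: borel_measurable_times_ennreal borel_measurable_indicator)
  also have "\<dots> \<le> (\<integral>\<^sup>+y. ennreal (x (obs y)) \<partial>\<iota>)"
    by (rule nn_integral_le_superharmonic[OF x0 xs Y_le])
  also have "\<dots> \<le> ennreal (\<Sum>w\<in>states N. iprob N w * x w)"
    by (rule nn_integral_init_le[OF x0])
  finally show ?thesis
    by (subst (asm) ennreal_le_iff) (auto intro!: sum_nonneg mult_nonneg_nonneg N_nonneg x0)
qed

end

lemma paths_states:
  assumes "mdp M" "\<SS> \<in> Sched M" "\<rho> \<in> paths M \<SS>"
  shows "\<rho> t \<in> states M"
  using assms hist_ok_path[OF assms(1,2)] by (auto simp: paths_def state_seq_def hist_ok_def)

theorem theorem3:
  fixes M :: "('s, 'a::finite, 'ap set) mdp"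
    and \<Phi> :: "('ap, 'n::finite, 'k::finite) phl"
    and D :: "('q, 'n \<Rightarrow> 's) dsa"
    and A :: "'k \<Rightarrow> ('r, ('ap \<times> 'n) set) dra"
    and N :: "((('n \<Rightarrow> 's) \<times> 'q) \<times> ('k \<Rightarrow> 'r), 'n \<Rightarrow> 'a, ('ap \<times> 'n) set) mdp"
    and x :: "(('n \<Rightarrow> 's) \<times> 'q) \<times> ('k \<Rightarrow> 'r) \<Rightarrow> real"
  assumes "mdp M"
    and "\<And>i. coef \<Phi> i > 0"
    and "bound \<Phi> \<in> \<rat>"
    and "cmp \<Phi> = (\<le>) \<or> cmp \<Phi> = (<)"
    and "dsa {s. \<forall>i. s i \<in> states M} D"
    and "\<And>w. (\<forall>t i. w t i \<in> states M) \<Longrightarrow>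
           dsa_accepts D w \<longleftrightarrow> psi_sat M (\<lambda>i t. w t i) (psi \<Phi>)"
    and "\<And>i. dra (A i)"
    and "\<And>i w. dra_accepts (A i) w \<longleftrightarrow> ltl_sat w (phi \<Phi> i)"
    and "N = M_tilde (M_chi M D) A"
    and "lp_optimal N A (coef \<Phi>) x"
    and "cmp \<Phi> (\<Sum>s\<in>states N. iprob N s * x s) (bound \<Phi>)"
  shows "M \<Turnstile> \<Phi>"
  unfolding phl_models_def
proof (intro allI impI)
  fix \<SS> :: "'n \<Rightarrow> ('s, 'a) scheduler"
  assume \<SS>: "\<forall>i. \<SS> i \<in> Sched M"
    and \<psi>: "\<forall>\<rho>. (\<forall>i. \<rho> i \<in> paths M (\<SS> i)) \<longrightarrow> psi_sat M \<rho> (psi \<Phi>)"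
  \<comment> \<open>The language of D is described only for words over states of M; scheduler paths
    stay there, so the premise becomes acceptance.\<close>
  interpret safe_schedulers M D A \<SS>
  proof
    fix w assume w: "\<And>i. (\<lambda>t. w t i) \<in> paths M (\<SS> i)"
    then have "\<forall>t i. w t i \<in> states M"
      using paths_states[OF assms(1)] \<SS> by blast
    then show "dsa_accepts D w"
      using assms(6) \<psi>[rule_format, of "\<lambda>i t. w t i"] w by simp
  qed (use assms(1,5,7) \<SS> in auto)
  have "(\<Sum>i\<in>UNIV. coef \<Phi> i * ltl_prob (self_comp M) (par_sched \<SS>) (phi \<Phi> i)) \<le>
      (\<Sum>s\<in>states N. iprob N s * x s)"
    using assms(10) unfolding assms(9) lp_optimal_def
    by (intro weighted_probability_le assms(2,8)) blast
  \<comment> \<open>Both admissible relations are preserved when the left side decreases.\<close>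
  then show "cmp \<Phi> (\<Sum>i\<in>UNIV. coef \<Phi> i * ltl_prob (self_comp M) (par_sched \<SS>) (phi \<Phi> i)) (bound \<Phi>)"
    using assms(4,11) by auto
qed

end
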